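(* For real $x>0$ let $$f_2(x)=\frac{e^{\pi i x}\,\Gamma(x+1)^2}{x^3\, \Gamma(2x+1)}.$$ Then the following series converge and $$\sum_{k=1}^\infty f_2''(k)=\frac{\pi^5}{25}i+\frac{8}{15}\pi^2\zeta(3)-\frac{52}5\zeta(5),$$ $$5\sum_{k=1}^\infty f_2^{(3)}(k)=4\pi i\big(\pi^2\zeta(3)-39\zeta(5)\big)-6\big(2\zeta(3)^2+3\zeta(6)\big),$$ $$\frac5{12}\sum_{k=1}^\infty f_2^{(4)}(k)=4\big(52\zeta(2)\zeta(5)-9\zeta(3)\zeta(4)-58\zeta(7)\big)+\pi i\big(57\zeta(6)-4\zeta(3)^2\big),$$ $$\frac16\sum_{k=1}^\infty f_2^{(5)}(k)=32\zeta(5,3)-48\zeta(3)\zeta(5)+32\zeta(2)\zeta(3)^2-303\zeta(8)+8\pi i\big(26\zeta(2)\zeta(5)-\zeta(3)\zeta(4)-58\zeta(7)\big),$$ $$\sum_{k=1}^\infty f_2^{(6)}(k)=96\big(696\zeta(2)\zeta(7)+3\zeta(3)\zeta(6)-2\zeta(3)^3-351\zeta(4)\zeta(5)-598\zeta(9)\big)+36\pi i\big(161\zeta(8)+16\zeta(2)\zeta(3)^2-48\zeta(3)\zeta(5)+32\zeta(5,3)\big).$$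
   Context: $i=\sqrt{-1}$, $e^{\pi i x}=\cos(\pi x)+i\sin(\pi x)$, and $\Gamma$ is Euler's gamma function. $f^{(m)}$ (also $f',f''$) denotes the $m$-th derivative of the complex-valued function $f$ of the real variable $x$. $\zeta(s)=\sum_{n\ge1}n^{-s}$ is the Riemann zeta function, and $\zeta(5,3)=\sum_{k_1>k_2>0}\frac{1}{k_1^5k_2^3}$. *)

theory Defs
  imports "HOL-Analysis.Analysis"
begin

text \<open>The Dirichlet series, which converges for \<open>Re s > 1\<close>; only such arguments are used, so no
  analytic continuation is involved.\<close>

definition zeta :: "complex \<Rightarrow> complex" where
  "zeta s = (\<Sum>n. of_nat (Suc n) powr (- s))"

definition double_zeta :: "nat \<Rightarrow> nat \<Rightarrow> complex" where
  "double_zeta a b =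
     (\<Sum>\<^sub>\<infinity>(k1, k2) \<in> {(k1, k2). k1 > k2 \<and> k2 > 0}. 1 / (of_nat k1 ^ a * of_nat k2 ^ b))"

text \<open>The library's \<^const>\<open>deriv\<close> differentiates functions from a field to itself, so derivatives
  of a complex-valued function of a real variable are taken with \<^const>\<open>vector_derivative\<close>.\<close>

definition nth_deriv :: "nat \<Rightarrow> (real \<Rightarrow> complex) \<Rightarrow> real \<Rightarrow> complex" where
  "nth_deriv m f = ((\<lambda>g x. vector_derivative g (at x)) ^^ m) f"

text \<open>Only the values at \<open>x > 0\<close> matter: derivatives are taken at positive integers.\<close>

definition f2 :: "real \<Rightarrow> complex" where
  "f2 x = exp (of_real pi * \<i> * of_real x) * of_real (Gamma (x + 1)) ^ 2
            / (of_real x ^ 3 * of_real (Gamma (2 * x + 1)))"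

end

theory Submission
  imports Defs "HOL-Complex_Analysis.Complex_Analysis" "HOL-Real_Asymp.Real_Asymp"
begin

text \<open>
  For complex \<open>n\<close> put \<open>F(n, k) = (-1)^n \<Gamma>(1+n)\<^sup>2 \<Gamma>(k-n) /
  (k\<^sup>2 \<Gamma>(k+n+1))\<close>. This is one half of a WZ pair, and summing the pair along
  the shifted diagonal \<open>(z+i, z+i+1)\<close> instead of along the line \<open>n =
  z\<close> gives, for small complex \<open>z\<close>, \<open>\<Sum>\<^sub>k (-1)^k
  \<Gamma>(k+z+1)\<^sup>2 / ((k+z)\<^sup>3 \<Gamma>(2k+2z+1)) = -2/5 \<cdot>
  \<Gamma>(1+z)\<^sup>2 / \<Gamma>(1+2z) \<cdot> V(z)\<close> with \<open>V(z) = \<Sum>\<^sub>k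
  1 / (k (k+z)\<^sup>2) \<cdot> \<Prod>\<^sub>j\<^sub>\<le>\<^sub>k j / (j+2z)\<close>. The sum
  of the \<open>m\<close>-th derivatives is \<open>m!\<close> times the \<open>m\<close>-th
  Taylor coefficient at \<open>0\<close> of \<open>e^(\<pi>iz)\<close> times this function. The
  coefficients of the Gamma quotient are polynomials in zeta values, and the \<open>m\<close>-th
  coefficient of \<open>V\<close> is an explicit integer combination of multiple zeta values of
  weight \<open>m + 3\<close>. For \<open>m \<le> 6\<close> finite double shuffle relations
  together with Hoffman's relation reduce it to the stated polynomials; each reduction is an
  explicit linear combination of such relations, which is verified by rewriting.
\<close>

section \<open>Multiple zeta values as sums over words\<close>

text \<open>Since e^(pi i k) = (-1)^k, the exponential only makes the series alternate: all
  derivatives at the positive integers are read off at z = 0 from the single function obtained by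
  summing f_2(k + z) over k. The obstacle is that the summands carry central binomial denominators,
  so none of the derivative series is visibly a combination of multiple zeta values; V has no such
  denominators. With g(z) = Gamma(1+z)^2 / Gamma(1+2z), the sum g(z) V(z) + g(z+1) V(z+1) is 5/2
  times the Gamma part of the summand at z + 1, and iterating this recurrence produces the
  alternating series. The 5 is 4 + 1, from the two boundary terms of a telescoping sum. Products of
  convergent values do not supply enough relations: zeta(2,1) = zeta(3) has weight 3, where no such
  product exists, so a renormalised product with the divergent zeta(1) has to be allowed. The same
  relations yield the even zeta values from zeta(2) = pi^2/6. The imaginary parts come from the odd
  powers of pi i in the exponential.\<close>

text \<open>
  A word \<open>X^(k\<^sub>1-1) Y X^(k\<^sub>2-1) Y \<dots>\<close> encodes
  \<open>\<zeta>(k\<^sub>1, k\<^sub>2, \<dots>)\<close>, the first index being the largest. The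
  \<open>n\<close>-th term collects the summands with largest index \<open>n\<close>; it is also
  the \<open>n\<close>-th coefficient of the multiple polylogarithm of the word. Since division
  by \<open>0\<close> gives \<open>0\<close>, the index \<open>0\<close> contributes to the
  empty word only, and words ending in \<open>X\<close> have value \<open>0\<close>.
\<close>

datatype letter = X | Y

fun mzv_coeff :: "letter list \<Rightarrow> nat \<Rightarrow> real" where
  "mzv_coeff [] n = (if n = 0 then 1 else 0)"
| "mzv_coeff (X # w) n = mzv_coeff w n / real n"
| "mzv_coeff (Y # w) n = (\<Sum>m<n. mzv_coeff w m) / real n"

definition mzv :: "letter list \<Rightarrow> real" where
  "mzv w = (\<Sum>n. mzv_coeff w n)"

section \<open>Growth of the coefficients and convergence\<close>

lemma mzv_coeff_nonneg: "mzv_coeff w n \<ge> 0"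
  by (induction w n rule: mzv_coeff.induct) (auto intro!: divide_nonneg_nonneg sum_nonneg)

lemma mzv_coeff_0: "w \<noteq> [] \<Longrightarrow> mzv_coeff w 0 = 0"
  by (cases "(w, 0::nat)" rule: mzv_coeff.cases) auto

lemma sum_inverse_sqrt_le: "(\<Sum>m<Suc n. 1 / sqrt (real m)) \<le> 2 * sqrt (real n)"
proof (induction n)
  case (Suc n)
  define a b where "a = sqrt (real n)" and "b = sqrt (real (Suc n))"
  have ab: "0 \<le> a" "a \<le> b" "0 < b" by (auto simp: a_def b_def)
  have "b^2 - a^2 = 1" by (simp add: a_def b_def)
  hence "(b - a) * (b + a) = 1" by (simp add: algebra_simps power2_eq_square)
  moreover have "(b - a) * (b + a) \<le> (b - a) * (2 * b)"
    using ab by (intro mult_left_mono) auto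
  ultimately have "1 / b \<le> 2 * (b - a)"
    using ab by (simp add: field_simps)
  with Suc show ?case by (simp add: a_def b_def)
qed auto

text \<open>The true growth is a power of a logarithm, but the square root bound is easier to
  propagate: \<open>X\<close> only shrinks coefficients, and \<open>Y\<close> divides partial sums
  of size sqrt n by n, giving 1 / sqrt n, whose partial sums are again of size sqrt n. One leading
  \<open>X\<close> then gives decay n^(-3/2), enough for convergence.\<close>

lemma mzv_coeff_bounds:
  obtains C where "C \<ge> 0" "\<And>n. (\<Sum>m<n. mzv_coeff w m) \<le> C * sqrt (real n)"
    "\<And>n. n > 0 \<Longrightarrow> mzv_coeff w n \<le> C / sqrt (real n)"
proof -
  have "\<exists>C\<ge>0. (\<forall>n. (\<Sum>m<n. mzv_coeff w m) \<le> C * sqrt (real n)) \<and>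
               (\<forall>n>0. mzv_coeff w n \<le> C / sqrt (real n))"
  proof (induction w)
    case Nil
    have "(\<Sum>m<n. mzv_coeff [] m) \<le> 1 * sqrt (real n)" for n
      by (cases n) (auto simp: sum.delta)
    thus ?case by (intro exI[of _ 1]) auto
  next
    case (Cons a w)
    then obtain C where C: "C \<ge> 0" "\<And>n. (\<Sum>m<n. mzv_coeff w m) \<le> C * sqrt (real n)"
      "\<And>n. n > 0 \<Longrightarrow> mzv_coeff w n \<le> C / sqrt (real n)" by blast
    show ?case
    proof (cases a)
      case X
      have le: "mzv_coeff w n / real n \<le> mzv_coeff w n" for n
        using divide_left_mono[of 1 "real n" "mzv_coeff w n"] mzv_coeff_nonneg[of w n] by (cases
            "n = 0") auto
      have "(\<Sum>m<n. mzv_coeff (a # w) m) \<le> C * sqrt (real n)" for n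
        using sum_mono[of "{..<n}" "mzv_coeff (a # w)" "mzv_coeff w"] C(2)[of n] le by (simp add: X)
      moreover have "mzv_coeff (a # w) n \<le> C / sqrt (real n)" if "n > 0" for n
        using C(3)[OF that] le[of n] by (simp add: X)
      ultimately show ?thesis using C(1) by blast
    next
      case Y
      have le: "mzv_coeff (a # w) n \<le> C / sqrt (real n)" for n
      proof -
        have "mzv_coeff (a # w) n \<le> C * sqrt (real n) / real n"
          using C(2)[of n] by (simp add: Y divide_right_mono)
        also have "\<dots> = C / sqrt (real n)"
          by (cases "n = 0") (auto simp: field_simps)
        finally show ?thesis .
      qed
      have "(\<Sum>m<n. mzv_coeff (a # w) m) \<le> 2 * C * sqrt (real n)" for n
      proof (cases n)
        case (Suc k)
        have "(\<Sum>m<n. mzv_coeff (a # w) m) \<le> (\<Sum>m<n. C * (1 / sqrt (real m)))"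
          using le by (intro sum_mono) simp
        also have "\<dots> = C * (\<Sum>m<n. 1 / sqrt (real m))"
          by (simp only: sum_distrib_left)
        also have "\<dots> \<le> C * (2 * sqrt (real k))"
          unfolding Suc by (intro mult_left_mono sum_inverse_sqrt_le C)
        also have "\<dots> \<le> C * (2 * sqrt (real n))"
          using C(1) Suc by (intro mult_left_mono) auto
        finally show ?thesis by simp
      qed auto
      moreover have "mzv_coeff (a # w) n \<le> 2 * C / sqrt (real n)" if "n > 0" for n
        by (rule order.trans[OF le]) (use C(1) in \<open>auto simp: divide_right_mono\<close>)
      ultimately show ?thesis using C(1) by (intro exI[of _ "2 * C"]) auto
    qed
  qed
  thus ?thesis using that by blast
qed

lemma summable_mzv_coeff: "summable (mzv_coeff (X # w))"
proof -
  obtain C where C: "C \<ge> 0" "\<And>n. n > 0 \<Longrightarrow> mzv_coeff w n \<le> C / sqrt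
      (real n)"
    using mzv_coeff_bounds[of w] by metis
  have "summable (\<lambda>n. C * real n powr (-3/2))"
    by (intro summable_mult) (simp add: summable_real_powr_iff)
  moreover have "norm (mzv_coeff (X # w) n) \<le> C * real n powr (-3/2)" for n
  proof (cases "n = 0")
    case False
    have "mzv_coeff (X # w) n \<le> C / sqrt (real n) / real n"
      unfolding mzv_coeff.simps by (rule divide_right_mono) (use C(2) False in auto)
    also have "\<dots> = C * (real n powr (-(1/2)) * real n powr (-1))"
      unfolding powr_minus powr_half_sqrt[OF of_nat_0_le_iff] by (simp add: divide_inverse)
    also have "\<dots> = C * real n powr (-3/2)"
      by (simp only: powr_add[symmetric]) simp
    finally show ?thesis using mzv_coeff_nonneg[of "X # w" n] by (simp del: mzv_coeff.simps)
  qed simp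
  ultimately show ?thesis by (rule summable_comparison_test'[where N = 0])
qed

lemma mzv_sums: "mzv_coeff (X # w) sums mzv (X # w)"
  unfolding mzv_def by (rule summable_sums[OF summable_mzv_coeff])

section \<open>Stuffle product\<close>

fun word :: "nat list \<Rightarrow> letter list" where
  "word [] = []"
| "word (k # ks) = replicate (k - 1) X @ Y # word ks"

lemma mzv_coeff_replicate_X: "mzv_coeff (replicate j X @ w) n = mzv_coeff w n / real n ^ j"
  by (induction j) (auto simp: field_simps)

lemma mzv_coeff_word_Cons:
  assumes "k > 0"
  shows "mzv_coeff (word (k # ks)) n = (\<Sum>m<n. mzv_coeff (word ks) m) / real n ^ k"
proof -
  have "real n ^ k = real n ^ (k - 1) * real n"
    using assms by (cases k) auto
  thus ?thesis using assms by (simp add: mzv_coeff_replicate_X field_simps)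
qed

fun stuffle :: "nat list \<Rightarrow> nat list \<Rightarrow> nat list list" where
  "stuffle [] v = [v]"
| "stuffle u [] = [u]"
| "stuffle (a # u) (b # v) = map ((#) a) (stuffle u (b # v)) @ map ((#) b) (stuffle (a # u) v)
     @ map ((#) (a + b)) (stuffle u v)"

lemma sum_lessThan_product:
  fixes f g :: "nat \<Rightarrow> real"
  shows "(\<Sum>m<n. f m) * (\<Sum>m<n. g m) =
    (\<Sum>m<n. f m * (\<Sum>i<m. g i) + (\<Sum>i<m. f i) * g m + f m * g m)"
  by (induction n) (auto simp: algebra_simps)

lemma sum_list_swap: "(\<Sum>x\<leftarrow>xs. \<Sum>m\<in>A. f x m) = (\<Sum>m\<in>A.
    \<Sum>x\<leftarrow>xs. (f x m :: real))"
  by (induction xs) (auto simp: sum.distrib)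

lemma sum_list_divide: "(\<Sum>x\<leftarrow>xs. f x) / (c::real) = (\<Sum>x\<leftarrow>xs. f x / c)"
  by (induction xs) (auto simp: add_divide_distrib)

text \<open>Comparing the largest summation indices of the two factors gives the cases greater,
  smaller and equal, which are the three branches of \<open>stuffle\<close>. The identity is stated
  for truncated sums because Hoffman's relation needs it for divergent words too. An entry 0 is
  excluded because truncated subtraction makes \<open>word\<close> treat it like 1.\<close>

lemma stuffle_mzv_coeff:
  assumes "0 \<notin> set u" "0 \<notin> set v"
  shows "(\<Sum>m<n. mzv_coeff (word u) m) * (\<Sum>m<n. mzv_coeff (word v) m)
       = (\<Sum>w\<leftarrow>stuffle u v. \<Sum>m<n. mzv_coeff (word w) m)"
  using assms
proof (induction u v arbitrary: n rule: stuffle.induct)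
  case (1 v)
  show ?case by (cases n) (auto simp: sum.delta)
next
  case (2 a u)
  show ?case by (cases n) (auto simp: sum.delta)
next
  case (3 a u b v)
  have ab: "a > 0" "b > 0" "a + b > 0" using 3 by auto
  define p where "p = (\<lambda>m. \<Sum>i<m. mzv_coeff (word u) i)"
  define q where "q = (\<lambda>m. \<Sum>i<m. mzv_coeff (word v) i)"
  define P where "P = (\<lambda>m. \<Sum>i<m. mzv_coeff (word (a # u)) i)"
  define Q where "Q = (\<lambda>m. \<Sum>i<m. mzv_coeff (word (b # v)) i)"
  have IH1: "p m * Q m = (\<Sum>w\<leftarrow>stuffle u (b # v). \<Sum>i<m. mzv_coeff (word w) i)"
   and IH2: "P m * q m = (\<Sum>w\<leftarrow>stuffle (a # u) v. \<Sum>i<m. mzv_coeff (word w) i)"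
   and IH3: "p m * q m = (\<Sum>w\<leftarrow>stuffle u v. \<Sum>i<m. mzv_coeff (word w) i)" for m
    unfolding p_def q_def P_def Q_def using 3 by auto
  have "P n * Q n = (\<Sum>m<n. mzv_coeff (word (a # u)) m * Q m + P m * mzv_coeff (word (b # v)) m
                      + mzv_coeff (word (a # u)) m * mzv_coeff (word (b # v)) m)"
    unfolding P_def Q_def by (rule sum_lessThan_product)
  also have "\<dots> = (\<Sum>m<n. p m * Q m / real m ^ a + P m * q m / real m ^ b
                      + p m * q m / real m ^ (a + b))"
    unfolding mzv_coeff_word_Cons[OF ab(1)] mzv_coeff_word_Cons[OF ab(2)]
    by (intro sum.cong refl) (simp add: power_add field_simps p_def q_def)
  also have "\<dots> = (\<Sum>w\<leftarrow>stuffle (a # u) (b # v). \<Sum>m<n. mzv_coeff (word w)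
      m)"
    unfolding IH1 IH2 IH3
    by (simp add: sum.distrib sum_list_swap[symmetric] sum_list_divide comp_def
        mzv_coeff_word_Cons[OF ab(1)]
          mzv_coeff_word_Cons[OF ab(2)] mzv_coeff_word_Cons[OF ab(3)] del: word.simps)
  finally show ?case unfolding P_def Q_def .
qed

section \<open>Shuffle product\<close>

fun shuffle_words :: "letter list \<Rightarrow> letter list \<Rightarrow> letter list list" where
  "shuffle_words [] v = [v]"
| "shuffle_words u [] = [u]"
| "shuffle_words (a # u) (b # v) = map ((#) a) (shuffle_words u (b # v)) @ map ((#) b)
    (shuffle_words (a # u) v)"

lemma shuffle_words_nonempty: "w \<in> set (shuffle_words u v) \<Longrightarrow> u \<noteq> []
    \<or> v \<noteq> [] \<Longrightarrow> w \<noteq> []"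
  by (induction u v rule: shuffle_words.induct) auto

definition mzv_fps :: "letter list \<Rightarrow> real fps" where
  "mzv_fps w = Abs_fps (mzv_coeff w)"

text \<open>The operator \<open>t d/dt\<close> strips the first letter, up to the factor
    \<open>1\<close> or \<open>t / (1-t)\<close>.\<close>

fun letter_fps :: "letter \<Rightarrow> real fps" where
  "letter_fps X = 1"
| "letter_fps Y = Abs_fps (\<lambda>n. if n = 0 then 0 else 1)"

lemma fps_theta_nth: "fps_nth (fps_X * fps_deriv f) n = (of_nat n * fps_nth f n :: real)"
  by (cases n) auto

text \<open>The word \<open>[X]\<close> must be excluded: division by 0 makes its series 0, whereas
  the rule would ask for a series with \<open>t d/dt\<close> equal to 1, that is, a
  logarithm.\<close>

lemma theta_mzv_fps:
  assumes "a = X \<Longrightarrow> w \<noteq> []"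
  shows "fps_X * fps_deriv (mzv_fps (a # w)) = letter_fps a * mzv_fps w"
proof (cases a)
  case X
  thus ?thesis using assms mzv_coeff_0[of w] by (auto simp: fps_eq_iff mzv_fps_def)
next
  case Y
  have "(\<Sum>i=0..n. (if i = 0 then 0 else 1) * mzv_coeff w (n - i)) = (\<Sum>m<n. mzv_coeff w
      m)" for n
  proof -
    have "(\<Sum>i=0..n. (if i = 0 then 0 else 1) * mzv_coeff w (n - i)) = (\<Sum>i\<in>{1..n}.
        mzv_coeff w (n - i))"
      by (intro sum.mono_neutral_cong_right) auto
    also have "\<dots> = (\<Sum>m<n. mzv_coeff w m)"
      by (intro sum.reindex_bij_witness[of _ "\<lambda>m. n - m" "\<lambda>m. n - m"]) auto
    finally show ?thesis .
  qed
  hence "real n * mzv_coeff (Y # w) n = (\<Sum>i=0..n. (if i = 0 then 0 else 1) * mzv_coeff w (n -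
      i))" for n
    by (cases "n = 0") auto
  thus ?thesis unfolding fps_eq_iff fps_theta_nth by (simp add: mzv_fps_def Y fps_mult_nth del:
      mzv_coeff.simps)
qed

lemma fps_theta_cancel:
  fixes f g :: "real fps"
  assumes "fps_X * fps_deriv f = fps_X * fps_deriv g" "fps_nth f 0 = fps_nth g 0"
  shows "f = g"
  using assms by (simp add: fps_deriv_eq_iff)

lemma fps_theta_sum_list:
  "fps_X * fps_deriv (\<Sum>x\<leftarrow>xs. f x) = (\<Sum>x\<leftarrow>xs. fps_X * fps_deriv (f x
      :: real fps))"
  by (induction xs) (auto simp: algebra_simps)

lemma sum_list_nth: "fps_nth (\<Sum>x\<leftarrow>xs. f x) n = (\<Sum>x\<leftarrow>xs. fps_nth (f
    x) n)"
  by (induction xs) auto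

lemma mzv_fps_Nil: "mzv_fps [] = 1"
  by (auto simp: mzv_fps_def fps_eq_iff)

text \<open>The operator \<open>t d/dt\<close> is a derivation, so on a product it strips the first
  letter of either factor, which is the recursion of \<open>shuffle_words\<close>. Constant terms
  vanish for nonempty words, so equality after \<open>t d/dt\<close> suffices. Ending in
  \<open>Y\<close> keeps the excluded word \<open>[X]\<close> from appearing as a suffix.\<close>

lemma shuffle_words_mzv_fps:
  assumes "u = [] \<or> last u = Y" "v = [] \<or> last v = Y"
  shows "mzv_fps u * mzv_fps v = (\<Sum>w\<leftarrow>shuffle_words u v. mzv_fps w)"
  using assms
proof (induction u v rule: shuffle_words.induct)
  case (3 a u b v)
  have IH1: "mzv_fps u * mzv_fps (b # v) = (\<Sum>w\<leftarrow>shuffle_words u (b # v). mzv_fps w)"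
   and IH2: "mzv_fps (a # u) * mzv_fps v = (\<Sum>w\<leftarrow>shuffle_words (a # u) v. mzv_fps w)"
    using 3 by (auto split: if_splits)
  have nz: "w \<noteq> []" if "w \<in> set (shuffle_words u (b # v)) \<union> set (shuffle_words
      (a # u) v)" for w
    using that shuffle_words_nonempty by blast
  have "fps_X * fps_deriv (mzv_fps (a # u) * mzv_fps (b # v)) =
          (fps_X * fps_deriv (mzv_fps (a # u))) * mzv_fps (b # v) + mzv_fps (a # u) * (fps_X *
              fps_deriv (mzv_fps (b # v)))"
    by (simp add: algebra_simps)
  also have "\<dots> = letter_fps a * (mzv_fps u * mzv_fps (b # v)) + letter_fps b * (mzv_fps (a #
      u) * mzv_fps v)"
    using 3 by (subst (1 2) theta_mzv_fps) (auto simp: algebra_simps)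
  also have "\<dots> = (\<Sum>w\<leftarrow>shuffle_words u (b # v). letter_fps a * mzv_fps w) +
      (\<Sum>w\<leftarrow>shuffle_words (a # u) v. letter_fps b * mzv_fps w)"
    by (simp only: IH1 IH2 sum_list_const_mult)
  also have "(\<Sum>w\<leftarrow>shuffle_words u (b # v). letter_fps a * mzv_fps w) =
      (\<Sum>w\<leftarrow>shuffle_words u (b # v). fps_X * fps_deriv (mzv_fps (a # w)))"
    by (intro arg_cong[of _ _ sum_list] map_cong refl theta_mzv_fps[symmetric]) (use nz in auto)
  also have "(\<Sum>w\<leftarrow>shuffle_words (a # u) v. letter_fps b * mzv_fps w) =
      (\<Sum>w\<leftarrow>shuffle_words (a # u) v. fps_X * fps_deriv (mzv_fps (b # w)))"
    by (intro arg_cong[of _ _ sum_list] map_cong refl theta_mzv_fps[symmetric]) (use nz in auto)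
  also have "(\<Sum>w\<leftarrow>shuffle_words u (b # v). fps_X * fps_deriv (mzv_fps (a # w))) +
      (\<Sum>w\<leftarrow>shuffle_words (a # u) v. fps_X * fps_deriv (mzv_fps (b # w))) =
      fps_X * fps_deriv (\<Sum>w\<leftarrow>shuffle_words (a # u) (b # v). mzv_fps w)"
    by (simp add: distrib_left fps_theta_sum_list comp_def)
  finally have "fps_X * fps_deriv (mzv_fps (a # u) * mzv_fps (b # v)) =
      fps_X * fps_deriv (\<Sum>w\<leftarrow>shuffle_words (a # u) (b # v). mzv_fps w)" .
  moreover have "fps_nth (mzv_fps (a # u) * mzv_fps (b # v)) 0 = fps_nth
      (\<Sum>w\<leftarrow>shuffle_words (a # u) (b # v). mzv_fps w) 0"
    by (simp add: mzv_fps_def mzv_coeff_0 sum_list_nth comp_def del: mzv_coeff.simps)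
  ultimately show ?case by (rule fps_theta_cancel)
qed (auto simp: mzv_fps_Nil)

fun admissible :: "letter list \<Rightarrow> bool" where
  "admissible (X # w) = True"
| "admissible w = False"

lemma admissible_sums: "admissible w \<Longrightarrow> mzv_coeff w sums mzv w"
  by (elim admissible.elims) (simp_all add: mzv_sums del: mzv_coeff.simps)

lemma sums_sum_list:
  assumes "\<And>x. x \<in> set xs \<Longrightarrow> f x sums (s x :: real)"
  shows "(\<lambda>n. \<Sum>x\<leftarrow>xs. f x n) sums (\<Sum>x\<leftarrow>xs. s x)"
  using assms
proof (induction xs)
  case (Cons x xs)
  have "(\<lambda>n. f x n + (\<Sum>x\<leftarrow>xs. f x n)) sums (s x + (\<Sum>x\<leftarrow>xs. s
      x))"
    by (intro sums_add Cons) (use Cons.prems in auto)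
  thus ?case by simp
qed auto

lemma admissible_word_Cons: "admissible (word (k # ks)) \<longleftrightarrow> k > 1"
proof (cases "k - 1")
  case (Suc j)
  thus ?thesis by simp
qed auto

lemma admissible_stuffle:
  "admissible (word u) \<Longrightarrow> admissible (word v) \<Longrightarrow> w \<in> set
      (stuffle u v) \<Longrightarrow> admissible (word w)"
  by (cases u; cases v) (auto simp: admissible_word_Cons simp del: word.simps)

lemma stuffle_mzv:
  assumes "0 \<notin> set u" "0 \<notin> set v" "admissible (word u)" "admissible (word v)"
  shows "mzv (word u) * mzv (word v) = (\<Sum>w\<leftarrow>stuffle u v. mzv (word w))"
proof (rule LIMSEQ_unique)
  show "(\<lambda>n. (\<Sum>m<n. mzv_coeff (word u) m) * (\<Sum>m<n. mzv_coeff (word v) m))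
      \<longlonglongrightarrow> mzv (word u) * mzv (word v)"
    using admissible_sums[OF assms(3)] admissible_sums[OF assms(4)]
    unfolding sums_def by (rule tendsto_mult)
  have "(\<lambda>m. \<Sum>w\<leftarrow>stuffle u v. mzv_coeff (word w) m) sums
      (\<Sum>w\<leftarrow>stuffle u v. mzv (word w))"
    by (intro sums_sum_list admissible_sums) (use admissible_stuffle assms in blast)
  thus "(\<lambda>n. (\<Sum>m<n. mzv_coeff (word u) m) * (\<Sum>m<n. mzv_coeff (word v) m))
      \<longlonglongrightarrow> (\<Sum>w\<leftarrow>stuffle u v. mzv (word w))"
    unfolding stuffle_mzv_coeff[OF assms(1,2)] sums_def by (simp add: sum_list_swap)
qed

lemma last_word: "w \<noteq> [] \<Longrightarrow> last (word w) = Y"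
  by (induction w rule: word.induct) (auto, metis word.simps(1))

lemma admissible_shuf:
  "admissible u \<Longrightarrow> admissible v \<Longrightarrow> w \<in> set (shuffle_words u v)
      \<Longrightarrow> admissible w"
  by (cases u; cases v) (auto elim!: admissible.elims)

lemma shuffle_words_mzv_coeff_nth:
  assumes "u = [] \<or> last u = Y" "v = [] \<or> last v = Y"
  shows "(\<Sum>i\<le>n. mzv_coeff u i * mzv_coeff v (n - i)) = (\<Sum>w\<leftarrow>shuffle_words
      u v. mzv_coeff w n)"
  using arg_cong[OF shuffle_words_mzv_fps[OF assms], of "\<lambda>f. fps_nth f n"]
  by (simp add: sum_list_nth fps_mult_nth mzv_fps_def atLeast0AtMost)

text \<open>This is the identity of power series at t = 1: coefficients of admissible words are
  nonnegative and summable, so their Cauchy product sums to the product of the values.\<close>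

lemma shuffle_words_mzv:
  assumes "admissible u" "admissible v" "last u = Y" "last v = Y"
  shows "mzv u * mzv v = (\<Sum>w\<leftarrow>shuffle_words u v. mzv w)"
proof (rule sums_unique2)
  have su: "summable (\<lambda>n. norm (mzv_coeff u n))" "summable (\<lambda>n. norm (mzv_coeff v
      n))"
    using admissible_sums[THEN sums_summable] assms(1,2) by (simp_all add: mzv_coeff_nonneg)
  show "(\<lambda>n. \<Sum>i\<le>n. mzv_coeff u i * mzv_coeff v (n - i)) sums (mzv u * mzv v)"
    using Cauchy_product_sums[OF su] by (simp add: mzv_def)
  show "(\<lambda>n. \<Sum>i\<le>n. mzv_coeff u i * mzv_coeff v (n - i)) sums
      (\<Sum>w\<leftarrow>shuffle_words u v. mzv w)"
    using assms by (subst shuffle_words_mzv_coeff_nth) (auto intro!: sums_sum_list admissible_sums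
        dest: admissible_shuf)
qed

text \<open>The stuffle product truncates to the square i, j < N, the shuffle product to the
  triangle i + j < N. Their difference is the corner where i + j is at least N. The sequence 1/i is
  the coefficient sequence of the divergent word \<open>[Y]\<close>.\<close>

lemma Cauchy_square_minus_triangle:
  fixes f :: "nat \<Rightarrow> real"
  shows "(\<Sum>j<N. 1 / real j) * (\<Sum>j<N. f j) - (\<Sum>n<N. \<Sum>i\<le>n. 1 / real i * f (n
      - i)) =
      (\<Sum>j<N. f j * (\<Sum>i | i < N \<and> N \<le> i + j. 1 / real i))"
proof -
  have "(\<Sum>n<N. \<Sum>i\<le>n. 1 / real i * f (n - i)) = (\<Sum>(j, i) \<in> {(j, i). i + j <
      N}. f j * (1 / real i))"
    unfolding sum.Sigma[OF finite_lessThan ballI[OF finite_atMost]]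
    by (intro sum.reindex_bij_witness[of _ "\<lambda>(j, i). (i + j, i)" "\<lambda>(n, i). (n - i,
        i)"]) auto
  also have "{(j, i). i + j < N} = (SIGMA j:{..<N}. {i. i < N \<and> i + j < N})" by auto
  also have "(\<Sum>(j, i) \<in> \<dots>. f j * (1 / real i)) = (\<Sum>j<N. \<Sum>i | i < N \<and>
      i + j < N. f j * (1 / real i))"
    by (intro sum.Sigma[symmetric]) auto
  also have "\<dots> = (\<Sum>j<N. f j * (\<Sum>i | i < N \<and> i + j < N. 1 / real i))"
    by (simp only: sum_distrib_left)
  finally have tri: "(\<Sum>n<N. \<Sum>i\<le>n. 1 / real i * f (n - i)) = \<dots>" .
  have "(\<Sum>i<N. 1 / real i) = (\<Sum>i | i < N \<and> i + j < N. 1 / real i) + (\<Sum>i | i <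
      N \<and> N \<le> i + j. 1 / real i)" for j
    by (subst sum.union_disjoint[symmetric]) (auto intro!: sum.cong)
  hence "(\<Sum>j<N. 1 / real j) * (\<Sum>j<N. f j) = (\<Sum>j<N. f j * ((\<Sum>i | i < N \<and> i
      + j < N. 1 / real i) +
      (\<Sum>i | i < N \<and> N \<le> i + j. 1 / real i)))"
    by (subst mult.commute) (simp only: sum_distrib_right)
  thus ?thesis unfolding tri by (simp add: ring_distribs sum.distrib)
qed

text \<open>The key is \<open>1/(ij) = (1/i + 1/j) / (i+j) \<le> (1/i + 1/j) / N\<close> on the
    range of summation.\<close>

lemma truncation_error_tendsto_0:
  "(\<lambda>N. (\<Sum>j<N. mzv_coeff (X # w) j * (\<Sum>i | i < N \<and> N \<le> i + j. 1 / real
      i))) \<longlonglongrightarrow> 0"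
proof -
  obtain C where C: "C \<ge> 0" "\<And>n. n > 0 \<Longrightarrow> mzv_coeff w n \<le> C / sqrt
      (real n)"
    using mzv_coeff_bounds[of w] by metis
  let ?s = "\<lambda>N. (\<Sum>j<N. mzv_coeff (X # w) j * (\<Sum>i | i < N \<and> N \<le> i + j. 1
      / real i))"
  have harm: "(\<Sum>i<N. 1 / real i) \<le> harm N" for N
  proof (cases N)
    case (Suc M)
    have "(\<Sum>i<N. 1 / real i) = (\<Sum>i\<in>{1..M}. 1 / real i)"
      unfolding Suc by (intro sum.mono_neutral_right) auto
    also have "\<dots> \<le> harm N"
      unfolding harm_def Suc inverse_eq_divide by (intro sum_mono2) auto
    finally show ?thesis .
  qed (auto simp: harm_def)
  have bound: "?s N \<le> C * (2 * harm N / sqrt (real N) + 2 / sqrt (real N))" if N: "N > 0" for N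
  proof -
    have "?s N = (\<Sum>j<N. \<Sum>i | i < N \<and> N \<le> i + j. mzv_coeff (X # w) j * (1 / real
        i))"
      by (simp only: sum_distrib_left)
    also have "\<dots> \<le> (\<Sum>j<N. \<Sum>i | i < N \<and> N \<le> i + j.
        C / real N * (1 / sqrt (real j) * (1 / real i) + 1 / sqrt (real j) * (1 / real j)))"
    proof (intro sum_mono)
      fix j i assume "j \<in> {..<N}" "i \<in> {i. i < N \<and> N \<le> i + j}"
      hence ij: "i > 0" "j > 0" "N \<le> i + j" by auto
      have "mzv_coeff (X # w) j * (1 / real i) \<le> C / sqrt (real j) / real j * (1 / real i)"
        unfolding mzv_coeff.simps by (intro mult_right_mono divide_right_mono C ij) auto
      also have "\<dots> = C / sqrt (real j) * (1 / (real i * real j))" by simp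
      also have "1 / (real i * real j) = 1 / (real i + real j) * (1 / real i + 1 / real j)"
        using ij by (simp add: divide_simps)
      also have "C / sqrt (real j) * \<dots> \<le> C / sqrt (real j) * (1 / real N * (1 / real i +
          1 / real j))"
        using ij N C(1) by (intro mult_left_mono mult_right_mono divide_left_mono) auto
      also have "\<dots> = C / real N * (1 / sqrt (real j) * (1 / real i) + 1 / sqrt (real j) * (1
          / real j))"
        by (simp add: ring_distribs mult_ac)
      finally show "mzv_coeff (X # w) j * (1 / real i) \<le> \<dots>" .
    qed
    also have "\<dots> = C / real N * ((\<Sum>j<N. 1 / sqrt (real j) * (\<Sum>i | i < N \<and> N
        \<le> i + j. 1 / real i)) +
        (\<Sum>j<N. 1 / sqrt (real j) * (\<Sum>i | i < N \<and> N \<le> i + j. 1 / real j)))"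
      by (simp only: sum_distrib_left sum.distrib distrib_left)
    also have "\<dots> \<le> C / real N * (2 * sqrt (real N) * harm N + 2 * sqrt (real N))"
    proof (intro mult_left_mono add_mono)
      have sq: "(\<Sum>j<N. 1 / sqrt (real j)) \<le> 2 * sqrt (real N)"
      proof (cases N)
        case (Suc M)
        have "2 * sqrt (real M) \<le> 2 * sqrt (real N)" using Suc by simp
        thus ?thesis using sum_inverse_sqrt_le[of M] unfolding Suc by linarith
      qed auto
      have "(\<Sum>j<N. 1 / sqrt (real j) * (\<Sum>i | i < N \<and> N \<le> i + j. 1 / real i))
          \<le>
            (\<Sum>j<N. 1 / sqrt (real j) * harm N)"
        by (intro sum_mono mult_left_mono order.trans[OF sum_mono2 harm]) auto
      also have "\<dots> \<le> 2 * sqrt (real N) * harm N"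
        unfolding sum_distrib_right[symmetric]
        by (intro mult_right_mono sq) (auto simp: harm_nonneg)
      finally show "(\<Sum>j<N. 1 / sqrt (real j) * (\<Sum>i | i < N \<and> N \<le> i + j. 1 /
          real i)) \<le>
        2 * sqrt (real N) * harm N" .
      have "(\<Sum>j<N. 1 / sqrt (real j) * (\<Sum>i | i < N \<and> N \<le> i + j. 1 / real j)) =
          (\<Sum>j<N. 1 / sqrt (real j))"
      proof (intro sum.cong refl)
        fix j assume j: "j \<in> {..<N}"
        \<comment> \<open>This interval has j elements, so the inner sum is 1; for
          \<open>j = 0\<close> both sides vanish because \<open>1 / sqrt 0 = 0\<close>.\<close>
        have "{i. i < N \<and> N \<le> i + j} = {N - j..<N}" using j by auto
        thus "1 / sqrt (real j) * (\<Sum>i | i < N \<and> N \<le> i + j. 1 / real j) = 1 / sqrt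
            (real j)"
          using j by (cases "j = 0") auto
      qed
      thus "(\<Sum>j<N. 1 / sqrt (real j) * (\<Sum>i | i < N \<and> N \<le> i + j. 1 / real j))
          \<le> 2 * sqrt (real N)"
        using sq by simp
    qed (use C in auto)
    also have "\<dots> = C * (2 * harm N / sqrt (real N) + 2 / sqrt (real N))"
    proof -
      define s where "s = sqrt (real N)"
      have s: "s > 0" "real N = s\<^sup>2" using N by (auto simp: s_def)
      show ?thesis unfolding s_def[symmetric] s(2) using s(1)
        by (simp add: field_simps power2_eq_square)
    qed
    finally show ?thesis .
  qed
  have nonneg: "?s N \<ge> 0" for N
    by (intro sum_nonneg mult_nonneg_nonneg mzv_coeff_nonneg) auto
  \<comment> \<open>The harmonic number is split into ln N and a convergent remainder, so that its
    quotient by sqrt N tends to 0.\<close>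
  have "(\<lambda>N. ln (real N) / real N powr (1/2)) \<longlonglongrightarrow> 0"
    by real_asymp
  moreover have "(\<lambda>N. harm N - ln (real N)) \<longlonglongrightarrow> euler_mascheroni"
    by (rule euler_mascheroni_LIMSEQ)
  moreover have "(\<lambda>N. 1 / real N powr (1/2)) \<longlonglongrightarrow> 0"
    by real_asymp
  ultimately have lim: "(\<lambda>N. C * (2 * (ln (real N) / real N powr (1/2) + (harm N - ln
      (real N)) * (1 / real N powr (1/2)))
      + 2 * (1 / real N powr (1/2)))) \<longlonglongrightarrow> C * (2 * (0 + euler_mascheroni *
          0) + 2 * 0)"
    by (intro tendsto_intros)
  have eq: "C * (2 * (ln (real N) / real N powr (1/2) + (harm N - ln (real N)) * (1 / real N powr
      (1/2)))
      + 2 * (1 / real N powr (1/2))) = C * (2 * harm N / sqrt (real N) + 2 / sqrt (real N))" for N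
    by (simp add: powr_half_sqrt diff_divide_distrib)
  have lim: "(\<lambda>N. C * (2 * harm N / sqrt (real N) + 2 / sqrt (real N)))
      \<longlonglongrightarrow> 0"
    using lim unfolding eq by simp
  show ?thesis
  proof (rule tendsto_sandwich[OF _ _ tendsto_const lim])
    show "\<forall>\<^sub>F N in sequentially. 0 \<le> ?s N" using nonneg by simp
    show "\<forall>\<^sub>F N in sequentially. ?s N \<le> C * (2 * harm N / sqrt (real N) + 2 /
        sqrt (real N))"
      by (rule eventually_mono[OF eventually_gt_at_top[of 0] bound])
  qed
qed

text \<open>
  Hoffman's relation: the products of \<open>\<zeta>(1)\<close> with a convergent value diverge,
  but the truncated stuffle and shuffle products contain the same divergent word (their head)
  and differ by an error tending to \<open>0\<close>.
\<close>

lemma hoffman_mzv: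
  assumes "0 \<notin> set ks" "k > 1"
  shows "(\<Sum>w\<leftarrow>tl (stuffle [1] (k # ks)). mzv (word w)) = (\<Sum>w\<leftarrow>tl
      (shuffle_words [Y] (word (k # ks))). mzv w)"
proof (rule LIMSEQ_unique)
  obtain k' where k: "k - 1 = Suc k'" using assms(2) by (cases "k - 1") auto
  define v where "v = replicate k' X @ Y # word ks"
  have v: "word (k # ks) = X # v" using k by (simp add: v_def)
  have lv: "last (X # v) = Y" unfolding v[symmetric] by (rule last_word) simp
  have st: "stuffle [1] (k # ks) = (1 # k # ks) # tl (stuffle [1] (k # ks))" by simp
  have sh: "shuffle_words [Y] (X # v) = (Y # X # v) # tl (shuffle_words [Y] (X # v))" by simp
  have st_adm: "admissible (word w)" if "w \<in> set (tl (stuffle [1] (k # ks)))" for w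
    using that assms by (auto simp: admissible_word_Cons simp del: word.simps)
  have sh_adm: "admissible w" if "w \<in> set (tl (shuffle_words [Y] (X # v)))" for w
    using that by auto
  have Y: "mzv_coeff [Y] j = 1 / real j" for j by (cases j) (auto simp: sum.delta)
  have A: "(\<Sum>j<N. mzv_coeff [Y] j) * (\<Sum>j<N. mzv_coeff (X # v) j) =
      (\<Sum>j<N. mzv_coeff (Y # X # v) j) + (\<Sum>w\<leftarrow>tl (stuffle [1] (k # ks)).
          \<Sum>j<N. mzv_coeff (word w) j)" for N
  proof -
    have "(\<Sum>j<N. mzv_coeff (word [1]) j) * (\<Sum>j<N. mzv_coeff (word (k # ks)) j) =
       (\<Sum>w\<leftarrow>stuffle [1] (k # ks). \<Sum>j<N. mzv_coeff (word w) j)"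
      using assms by (intro stuffle_mzv_coeff) auto
    also have "word [1] = [Y]" by simp
    also have "(\<Sum>w\<leftarrow>stuffle [1] (k # ks). \<Sum>j<N. mzv_coeff (word w) j) =
       (\<Sum>j<N. mzv_coeff (word (1 # k # ks)) j) + (\<Sum>w\<leftarrow>tl (stuffle [1] (k #
           ks)). \<Sum>j<N. mzv_coeff (word w) j)"
      by (subst st) (simp only: list.map sum_list.Cons)
    also have "word (1 # k # ks) = Y # X # v" by (simp add: v[symmetric])
    finally show ?thesis unfolding v .
  qed
  have B: "(\<Sum>n<N. \<Sum>i\<le>n. mzv_coeff [Y] i * mzv_coeff (X # v) (n - i)) =
      (\<Sum>j<N. mzv_coeff (Y # X # v) j) + (\<Sum>w\<leftarrow>tl (shuffle_words [Y] (X # v)).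
          \<Sum>j<N. mzv_coeff w j)" for N
  proof -
    have "(\<Sum>n<N. \<Sum>i\<le>n. mzv_coeff [Y] i * mzv_coeff (X # v) (n - i)) = (\<Sum>n<N.
        \<Sum>w\<leftarrow>shuffle_words [Y] (X # v). mzv_coeff w n)"
      using lv by (intro sum.cong refl shuffle_words_mzv_coeff_nth) auto
    also have "\<dots> = (\<Sum>n<N. mzv_coeff (Y # X # v) n + (\<Sum>w\<leftarrow>tl
        (shuffle_words [Y] (X # v)). mzv_coeff w n))"
      by (subst sh) (simp only: list.map sum_list.Cons)
    finally show ?thesis by (simp only: sum.distrib sum_list_swap)
  qed
  let ?e = "\<lambda>N. (\<Sum>j<N. mzv_coeff (X # v) j * (\<Sum>i | i < N \<and> N \<le> i + j. 1
      / real i))"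
  have "?e N = (\<Sum>w\<leftarrow>tl (stuffle [1] (k # ks)). \<Sum>j<N. mzv_coeff (word w) j) -
      (\<Sum>w\<leftarrow>tl (shuffle_words [Y] (X # v)). \<Sum>j<N. mzv_coeff w j)" for N
    using A[of N] B[of N] Cauchy_square_minus_triangle[of N "mzv_coeff (X # v)"] unfolding Y by
        linarith
  hence eq: "(\<Sum>w\<leftarrow>tl (stuffle [1] (k # ks)). \<Sum>j<N. mzv_coeff (word w) j) =
     (\<Sum>w\<leftarrow>tl (shuffle_words [Y] (X # v)). \<Sum>j<N. mzv_coeff w j) + ?e N" for N
         by simp
  have "(\<lambda>j. \<Sum>w\<leftarrow>tl (stuffle [1] (k # ks)). mzv_coeff (word w) j) sums
      (\<Sum>w\<leftarrow>tl (stuffle [1] (k # ks)). mzv (word w))"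
    by (intro sums_sum_list admissible_sums st_adm)
  thus "(\<lambda>N. \<Sum>w\<leftarrow>tl (stuffle [1] (k # ks)). \<Sum>j<N. mzv_coeff (word w)
      j) \<longlonglongrightarrow> (\<Sum>w\<leftarrow>tl (stuffle [1] (k # ks)). mzv (word w))"
    by (simp only: sums_def sum_list_swap)
  have "(\<lambda>j. \<Sum>w\<leftarrow>tl (shuffle_words [Y] (X # v)). mzv_coeff w j) sums
      (\<Sum>w\<leftarrow>tl (shuffle_words [Y] (X # v)). mzv w)"
    by (intro sums_sum_list admissible_sums sh_adm)
  hence "(\<lambda>N. \<Sum>w\<leftarrow>tl (shuffle_words [Y] (X # v)). \<Sum>j<N. mzv_coeff w j)
      \<longlonglongrightarrow> (\<Sum>w\<leftarrow>tl (shuffle_words [Y] (X # v)). mzv w)"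
    by (simp only: sums_def sum_list_swap)
  from tendsto_add[OF this truncation_error_tendsto_0]
  show "(\<lambda>N. \<Sum>w\<leftarrow>tl (stuffle [1] (k # ks)). \<Sum>j<N. mzv_coeff (word w)
      j) \<longlonglongrightarrow> (\<Sum>w\<leftarrow>tl (shuffle_words [Y] (word (k # ks))). mzv
      w)"
    unfolding eq v by simp
qed

section \<open>Linear certificates for relations between multiple zeta values\<close>

text \<open>
  Integer combinations of words are stored in binary tries, so that checking that a combination
  of relations cancels is cheap for the simplifier. Left subtrees belong to \<open>X\<close>.
\<close>

datatype trie = Leaf | Node int trie trie

fun trie_eval :: "(letter list \<Rightarrow> real) \<Rightarrow> trie \<Rightarrow> real" where
  "trie_eval f Leaf = 0"
| "trie_eval f (Node c l r) = of_int c * f [] + trie_eval (\<lambda>w. f (X # w)) l + trie_eval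
    (\<lambda>w. f (Y # w)) r"

fun trie_insert :: "int \<Rightarrow> letter list \<Rightarrow> trie \<Rightarrow> trie" where
  "trie_insert c [] Leaf = Node c Leaf Leaf"
| "trie_insert c (X # w) Leaf = Node 0 (trie_insert c w Leaf) Leaf"
| "trie_insert c (Y # w) Leaf = Node 0 Leaf (trie_insert c w Leaf)"
| "trie_insert c [] (Node d l r) = Node (c + d) l r"
| "trie_insert c (X # w) (Node d l r) = Node d (trie_insert c w l) r"
| "trie_insert c (Y # w) (Node d l r) = Node d l (trie_insert c w r)"

fun trie_axpy :: "int \<Rightarrow> trie \<Rightarrow> trie \<Rightarrow> trie" where
  "trie_axpy c Leaf t = t"
| "trie_axpy c (Node d l r) Leaf = Node (c * d) (trie_axpy c l Leaf) (trie_axpy c r Leaf)"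
| "trie_axpy c (Node d l r) (Node d' l' r') = Node (c * d + d') (trie_axpy c l l') (trie_axpy c r
    r')"

fun trie_zero :: "trie \<Rightarrow> bool" where
  "trie_zero Leaf = True"
| "trie_zero (Node c l r) \<longleftrightarrow> c = 0 \<and> trie_zero l \<and> trie_zero r"

lemma trie_eval_insert: "trie_eval f (trie_insert c w t) = of_int c * f w + trie_eval f t"
  by (induction c w t arbitrary: f rule: trie_insert.induct) (auto simp: algebra_simps)

lemma trie_eval_axpy: "trie_eval f (trie_axpy c s t) = of_int c * trie_eval f s + trie_eval f t"
  by (induction c s t arbitrary: f rule: trie_axpy.induct) (auto simp: algebra_simps)

lemma trie_eval_zero: "trie_zero t \<Longrightarrow> trie_eval f t = 0"
  by (induction t arbitrary: f) auto

definition insert_words :: "int \<Rightarrow> letter list list \<Rightarrow> trie \<Rightarrow>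
    trie" where
  "insert_words c ws t = fold (trie_insert c) ws t"

lemma trie_eval_insert_words:
  "trie_eval f (insert_words c ws t) = of_int c * (\<Sum>w\<leftarrow>ws. f w) + trie_eval f t"
  unfolding insert_words_def
  by (induction ws arbitrary: t) (auto simp: trie_eval_insert algebra_simps)

text \<open>The marker \<open>[1]\<close> selects Hoffman's relation, where \<open>tl\<close> drops
  the divergent word that heads both products.\<close>

definition double_shuffle_trie :: "nat list \<Rightarrow> nat list \<Rightarrow> trie" where
  "double_shuffle_trie u v =
     (if u = [1] then insert_words 1 (map word (tl (stuffle u v))) (insert_words (-1) (tl
         (shuffle_words (word u) (word v))) Leaf)
      else insert_words 1 (map word (stuffle u v)) (insert_words (-1) (shuffle_words (word u)
          (word v)) Leaf))"

fun index_ok :: "nat list \<Rightarrow> bool" where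
  "index_ok [] \<longleftrightarrow> False"
| "index_ok (k # ks) \<longleftrightarrow> k > 1 \<and> 0 \<notin> set ks"

lemma index_okD:
  assumes "index_ok u"
  shows "0 \<notin> set u" "admissible (word u)" "last (word u) = Y"
proof -
  obtain k ks where u: "u = k # ks" using assms by (cases u) auto
  show "0 \<notin> set u" "admissible (word u)" "last (word u) = Y"
    using assms u last_word[of u] by (auto simp: admissible_word_Cons simp del: word.simps)
qed

lemma trie_eval_double_shuffle:
  assumes "u = [1] \<or> index_ok u" "index_ok v"
  shows "trie_eval mzv (double_shuffle_trie u v) = 0"
proof (cases "u = [1]")
  case True
  obtain k ks where v: "v = k # ks" using assms(2) by (cases v) auto
  have "0 \<notin> set ks" "k > 1" using assms(2) v by auto
  from hoffman_mzv[OF this] show ?thesis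
    using True by (simp add: double_shuffle_trie_def trie_eval_insert_words v comp_def
      del: word.simps(2) stuffle.simps shuffle_words.simps)
      (simp add: word.simps(1))
next
  case False
  with assms have u: "index_ok u" by simp
  have "(\<Sum>w\<leftarrow>stuffle u v. mzv (word w)) = (\<Sum>w\<leftarrow>shuffle_words (word
      u) (word v). mzv w)"
    using stuffle_mzv[of u v] shuffle_words_mzv[of "word u" "word v"] index_okD[OF u] index_okD[OF
        assms(2)] by simp
  thus ?thesis using False by (simp add: double_shuffle_trie_def trie_eval_insert_words comp_def)
qed

definition certificate_trie :: "(int \<times> nat list \<times> nat list) list \<Rightarrow> trie
    \<Rightarrow> trie" where
  "certificate_trie cs t = fold (\<lambda>(c, u, v). trie_axpy c (double_shuffle_trie u v)) cs t"

definition certificate_ok :: "(int \<times> nat list \<times> nat list) list \<Rightarrow> bool"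
    where
  "certificate_ok cs \<longleftrightarrow> list_all (\<lambda>(c, u, v). (u = [1] \<or> index_ok
      u) \<and> index_ok v) cs"

lemma trie_eval_certificate:
  "certificate_ok cs \<Longrightarrow> trie_eval mzv (certificate_trie cs t) = trie_eval mzv t"
  unfolding certificate_trie_def certificate_ok_def
  by (induction cs arbitrary: t) (auto simp: trie_eval_axpy trie_eval_double_shuffle)

text \<open>Each relation evaluates to 0, so adding multiples of relations does not change the value
  of \<open>t\<close>. If all coefficients then cancel formally, that value is 0.\<close>

lemma certificate_sound:
  "certificate_ok cs \<Longrightarrow> trie_zero (certificate_trie cs t) \<Longrightarrow>
      trie_eval mzv t = 0"
  using trie_eval_certificate[of cs t] trie_eval_zero by simp

text \<open>All words of the given length that end in \<open>Y\<close>. Their values add up to a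
  non-strict nested sum with all exponents 1: a letter \<open>X\<close> identifies neighbouring
  summation indices, and a letter \<open>Y\<close> separates them strictly.\<close>

fun y_words :: "nat \<Rightarrow> letter list list" where
  "y_words 0 = [[]]"
| "y_words (Suc 0) = [[Y]]"
| "y_words (Suc (Suc n)) = map ((#) X) (y_words (Suc n)) @ map ((#) Y) (y_words (Suc n))"

text \<open>The m-th Taylor coefficient of V in terms of words: \<open>a\<close> is the degree taken
  from (k + z)^(-2), which contributes (-1)^a (a + 1) / k^(a + 2), and \<open>m - a\<close> the
  degree taken from the product, which contributes (-2)^(m - a) times a non-strict sum. The
  remaining factor 1/k accounts for the extra letter in \<open>y_words (m - a + 1)\<close>.\<close>

definition dual_words :: "nat \<Rightarrow> (int \<times> letter list list) list" where
  "dual_words m = map (\<lambda>a. ((- 1) ^ m * (int a + 1) * 2 ^ (m - a),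
      map ((@) (replicate (a + 2) X)) (y_words (m - a + 1)))) [0..<Suc m]"

fun stuffle_list :: "nat list list \<Rightarrow> nat list list" where
  "stuffle_list [] = [[]]"
| "stuffle_list (u # us) = concat (map (stuffle u) (stuffle_list us))"

definition combination_trie :: "(int \<times> letter list list) list \<Rightarrow> trie" where
  "combination_trie cs = fold (\<lambda>(c, ws). insert_words c ws) cs Leaf"

lemma index_ok_stuffle:
  assumes "index_ok u" "index_ok v" "w \<in> set (stuffle u v)"
  shows "index_ok w"
proof -
  have zero: "0 \<notin> set w" if "0 \<notin> set u" "0 \<notin> set v" "w \<in> set (stuffle u
      v)" for u v w
    using that
  proof (induction u v arbitrary: w rule: stuffle.induct)
    case (3 a u b v)
    from 3(6) consider w' where "w = a # w'" "w' \<in> set (stuffle u (b # v))"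
      | w' where "w = b # w'" "w' \<in> set (stuffle (a # u) v)"
      | w' where "w = (a + b) # w'" "w' \<in> set (stuffle u v)" by auto
    thus ?case
    proof cases
      case 1
      thus ?thesis using 3(1)[of w'] 3(4,5) by simp
    next
      case 2
      thus ?thesis using 3(2)[of w'] 3(4,5) by simp
    next
      case 3
      thus ?thesis using "3.IH"(3)[of w'] "3.prems"(1,2) by simp
    qed
  qed simp_all
  obtain a u' b v' where uv: "u = a # u'" "v = b # v'"
    using assms by (cases u; cases v) auto
  from assms(3) consider w' where "w = a # w'" "w' \<in> set (stuffle u' (b # v'))"
    | w' where "w = b # w'" "w' \<in> set (stuffle (a # u') v')"
    | w' where "w = (a + b) # w'" "w' \<in> set (stuffle u' v')" unfolding uv by auto
  thus ?thesis
  proof cases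
    case (1 w')
    thus ?thesis using zero[OF _ _ 1(2)] assms(1,2) uv by simp
  next
    case (2 w')
    thus ?thesis using zero[OF _ _ 2(2)] assms(1,2) uv by simp
  next
    case (3 w')
    thus ?thesis using zero[OF _ _ 3(2)] assms(1,2) uv by simp
  qed
qed

lemma mzv_Nil: "mzv [] = 1"
  unfolding mzv_def mzv_coeff.simps by (rule sums_unique[OF sums_single[of 0 "\<lambda>_. 1 ::
      real"], symmetric])

lemma stuffle_list_mzv:
  assumes "list_all index_ok us"
  shows "(\<Prod>u\<leftarrow>us. mzv (word u)) = (\<Sum>w\<leftarrow>stuffle_list us. mzv (word
      w))"
    "w \<in> set (stuffle_list us) \<Longrightarrow> w = [] \<or> index_ok w"
proof -
  have step: "mzv (word u) * mzv (word v) = (\<Sum>w\<leftarrow>stuffle u v. mzv (word w)) \<and>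
      (\<forall>w\<in>set (stuffle u v). index_ok w)"
    if "index_ok u" "v = [] \<or> index_ok v" for u v
  proof (cases "v = []")
    case True
    have "stuffle u [] = [u]" by (cases u) auto
    thus ?thesis using True that by (simp add: mzv_Nil)
  next
    case False
    hence "index_ok v" using that by simp
    thus ?thesis using stuffle_mzv[of u v] index_okD[OF that(1)] index_okD[of v]
        index_ok_stuffle[OF that(1)] by blast
  qed
  have "(\<Prod>u\<leftarrow>us. mzv (word u)) = (\<Sum>w\<leftarrow>stuffle_list us. mzv (word
      w)) \<and> (\<forall>w\<in>set (stuffle_list us). w = [] \<or> index_ok w)"
    using assms
  proof (induction us)
    case (Cons u us)
    hence IH: "(\<Prod>u\<leftarrow>us. mzv (word u)) = (\<Sum>w\<leftarrow>stuffle_list us. mzv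
        (word w))"
      "\<forall>w\<in>set (stuffle_list us). w = [] \<or> index_ok w" and u: "index_ok u" by auto
    have "mzv (word u) * (\<Sum>w\<leftarrow>ws. mzv (word w)) = (\<Sum>w\<leftarrow>concat (map
        (stuffle u) ws). mzv (word w))"
      if "\<forall>w\<in>set ws. w = [] \<or> index_ok w" for ws
      using that step[OF u] by (induction ws) (auto simp: distrib_left)
    thus ?case using IH step[OF u] by auto
  qed (auto simp: mzv_Nil)
  thus "(\<Prod>u\<leftarrow>us. mzv (word u)) = (\<Sum>w\<leftarrow>stuffle_list us. mzv (word w))"
    "w \<in> set (stuffle_list us) \<Longrightarrow> w = [] \<or> index_ok w" by auto
qed

lemma trie_eval_combination:
  "trie_eval f (combination_trie cs) = (\<Sum>(c, ws)\<leftarrow>cs. of_int c *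
      (\<Sum>w\<leftarrow>ws. f w))"
proof -
  have "trie_eval f (fold (\<lambda>(c, ws). insert_words c ws) cs t) =
     (\<Sum>(c, ws)\<leftarrow>cs. of_int c * (\<Sum>w\<leftarrow>ws. f w)) + trie_eval f t" for t
    by (induction cs arbitrary: t) (auto simp: trie_eval_insert_words)
  thus ?thesis by (simp add: combination_trie_def)
qed

section \<open>The WZ identity\<close>

text \<open>Equal to k! Gamma(1 + 2z) / Gamma(k + 1 + 2z), the reciprocal of a generalised binomial
  coefficient.\<close>

definition shift_prod :: "nat \<Rightarrow> complex \<Rightarrow> complex" where
  "shift_prod k z = (\<Prod>j=1..k. of_nat j / (of_nat j + 2 * z))"

definition dual_term :: "nat \<Rightarrow> complex \<Rightarrow> complex" where
  "dual_term k z = shift_prod k z / (of_nat k * (of_nat k + z) ^ 2)"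

lemma shift_prod_0 [simp]: "shift_prod 0 z = 1" by (simp add: shift_prod_def)

lemma shift_prod_Suc: "shift_prod (Suc k) z = shift_prod k z * (of_nat (Suc k) / (of_nat (Suc k) +
    2 * z))"
  by (simp add: shift_prod_def)

lemma nonzero_of_Re_pos: "Re z > 0 \<Longrightarrow> z \<noteq> 0" by auto

lemma Gamma_plus1_Re_pos: "Re z > 0 \<Longrightarrow> Gamma (z + 1) = z * Gamma z"
  by (rule Gamma_plus1) (auto elim!: nonpos_Ints_cases)

lemma norm_le_norm_add_of_real:
  assumes "Re w \<ge> 0" "t \<ge> 0"
  shows "norm w \<le> norm (of_real t + w)"
  unfolding cmod_def using assms by (intro real_sqrt_le_mono) (auto intro!: power_mono)

text \<open>In this half-plane \<open>j + 2 * z\<close> has real part at least j - 1/2, so the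
  product grows at most linearly. Against the cubic denominator of \<open>dual_term\<close> this
  leaves quadratic decay uniformly in z.\<close>

lemma norm_shift_prod_le:
  assumes "Re z \<ge> -1/4"
  shows "norm (shift_prod k z) \<le> 2 * real k + 1"
proof (induction k)
  case (Suc k)
  have "real (Suc k) - 1/2 \<le> Re (of_nat (Suc k) + 2 * z)" using assms by simp
  hence le: "real (Suc k) - 1/2 \<le> norm (of_nat (Suc k) + 2 * z)"
    using complex_Re_le_cmod order.trans by blast
  have "norm (shift_prod (Suc k) z) = norm (shift_prod k z) * (real (Suc k) / norm (of_nat (Suc k)
      + 2 * z))"
    unfolding shift_prod_Suc norm_mult norm_divide norm_of_nat ..
  also have "\<dots> \<le> (2 * real k + 1) * (real (Suc k) / (real (Suc k) - 1/2))"
    by (intro mult_mono divide_left_mono le Suc) (use le in \<open>auto intro!: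
        mult_pos_pos\<close>)
  also have "\<dots> = 2 * real (Suc k)"
    by (simp add: field_simps)
  finally show ?case by simp
qed auto

lemma norm_dual_term_le:
  assumes "Re z \<ge> -1/4" "k > 0"
  shows "norm (dual_term k z) \<le> 6 / real k ^ 2"
proof -
  have "real k - 1/4 \<le> Re (of_nat k + z)" using assms by simp
  hence le: "real k - 1/4 \<le> norm (of_nat k + z)"
    using complex_Re_le_cmod order.trans by blast
  have le2: "3/4 * real k \<le> norm (of_nat k + z)" using le assms by simp
  have "norm (dual_term k z) = norm (shift_prod k z) / (real k * norm (of_nat k + z) ^ 2)"
    by (simp add: dual_term_def norm_divide norm_mult norm_power)
  also have "\<dots> \<le> (3 * real k) / (real k * (3/4 * real k) ^ 2)"
    using norm_shift_prod_le[OF assms(1), of k] assms(2) le2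
    by (intro frac_le mult_left_mono power_mono) auto
  also have "\<dots> = (16/3) / real k ^ 2"
    using assms(2) by (simp add: field_simps power2_eq_square)
  also have "\<dots> \<le> 6 / real k ^ 2" by (intro divide_right_mono) auto
  finally show ?thesis .
qed

definition dual_series :: "complex \<Rightarrow> complex" where
  "dual_series z = (\<Sum>k. dual_term (Suc k) z)"

lemma summable_inverse_squares: "summable (\<lambda>k. 6 / real (Suc k) ^ 2)"
  using summable_mult[OF inverse_squares_sums[THEN sums_summable], of 6] by (simp add: add_ac)

lemma norm_dual_term_Suc_le:
  assumes "Re z \<ge> -1/4"
  shows "norm (dual_term (Suc k) z) \<le> 6 / real (Suc k) ^ 2"
  using norm_dual_term_le[OF assms, of "Suc k"] by simp

lemma dual_term_sums: "Re z \<ge> -1/4 \<Longrightarrow> (\<lambda>k. dual_term (Suc k) z) sums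
    dual_series z"
  unfolding dual_series_def
  by (intro summable_sums summable_comparison_test'[OF summable_inverse_squares
      norm_dual_term_Suc_le])

text \<open>The reciprocal of the central binomial coefficient, interpolated to complex
  arguments.\<close>

definition gamma_quot :: "complex \<Rightarrow> complex" where
  "gamma_quot z = Gamma (1 + z) ^ 2 / Gamma (1 + 2 * z)"

lemma gamma_quot_plus1:
  assumes "Re z \<ge> -1/4"
  shows "gamma_quot (z + 1) = gamma_quot z * ((1 + z) / (2 * (1 + 2 * z)))"
proof -
  have nz: "1 + z \<noteq> 0" "1 + 2 * z \<noteq> 0" "1 + 1 + 2 * z \<noteq> 0"
    by (intro nonzero_of_Re_pos; use assms in simp)+
  have "Gamma (1 + 2 * (z + 1)) = Gamma ((1 + 1 + 2 * z) + 1)" by (simp add: algebra_simps)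
  also have "\<dots> = (1 + 1 + 2 * z) * Gamma ((1 + 2 * z) + 1)"
    using Gamma_plus1_Re_pos[of "1 + 1 + 2 * z"] assms by (simp add: add_ac)
  also have "\<dots> = (1 + 1 + 2 * z) * ((1 + 2 * z) * Gamma (1 + 2 * z))"
    by (subst Gamma_plus1_Re_pos) (use assms in auto)
  finally have 1: "Gamma (1 + 2 * (z + 1)) = \<dots>" .
  have 2: "Gamma (1 + (z + 1)) = (1 + z) * Gamma (1 + z)"
    using Gamma_plus1_Re_pos[of "1 + z"] assms by (simp add: add_ac)
  have aux: "(a * g)^2 / ((2 * a) * (b * h)) = g^2 / h * (a / (2 * b))" if "a \<noteq> 0" for a b
      g h :: complex
    using that by (simp add: power2_eq_square mult_ac)
  have "1 + 1 + 2 * z = 2 * (1 + z)" by simp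
  thus ?thesis unfolding gamma_quot_def 1 2 using aux[OF nz(1)] by simp
qed

text \<open>Replacing n by n + 1 shifts the denominators by 2: the first two are lost and two new
  ones are gained at the end.\<close>

lemma shift_prod_plus1:
  assumes "Re n \<ge> -1/4"
  shows "shift_prod k (n + 1) = shift_prod k n * ((1 + 2 * n) * (2 + 2 * n) /
    ((of_nat k + 1 + 2 * n) * (of_nat k + 2 + 2 * n)))"
proof (induction k)
  case 0
  have nz: "1 + 2 * n \<noteq> 0" "2 + 2 * n \<noteq> 0"
    by (intro nonzero_of_Re_pos; use assms in simp)+
  thus ?case by simp
next
  case (Suc k)
  have nz: "of_nat k + 1 + 2 * n \<noteq> 0" "of_nat k + 2 + 2 * n \<noteq> 0" "of_nat k + 3 + 2 *
      n \<noteq> 0"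
    by (intro nonzero_of_Re_pos; use assms in simp)+
  have eq: "of_nat (Suc k) + 2 * (n + 1) = of_nat k + 3 + 2 * n" "of_nat (Suc k) + 1 + 2 * n =
      of_nat k + 2 + 2 * n"
     "of_nat (Suc k) + 2 + 2 * n = of_nat k + 3 + 2 * n" "of_nat (Suc k) + 2 * n = of_nat k + 1 +
         2 * n"
    by simp_all
  show ?case unfolding shift_prod_Suc Suc eq using nz by (simp add: divide_simps)
qed

lemma dual_term_plus1:
  assumes "Re n \<ge> -1/4"
  shows "(1 + n) / (2 * (1 + 2 * n)) * dual_term k (n + 1) = shift_prod k n * (1 + n)^2 /
    (of_nat k * (of_nat k + 1 + 2 * n) * (of_nat k + 2 + 2 * n) * (of_nat k + 1 + n)^2)"
proof -
  have aux: "a / (2 * b) * (q * (b * (2 * a) / (x * y)) / (k * z)) = q * a^2 / (k * x * y * z)"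
    if "b \<noteq> 0" for a b q k x y z :: complex
    using that by (simp add: power2_eq_square divide_simps)
  have "1 + 2 * n \<noteq> 0" by (rule nonzero_of_Re_pos) (use assms in simp)
  from aux[OF this, of "1 + n" "shift_prod k n" "of_nat k + 1 + 2 * n" "of_nat k + 2 + 2 * n"
      "of_nat k" "(of_nat k + 1 + n)^2"]
  show ?thesis unfolding dual_term_def shift_prod_plus1[OF assms] by (simp add: add_ac)
qed

text \<open>The WZ pair, combined along a diagonal step and divided by
    \<open>\<Gamma>(1+n)\<^sup>2 / \<Gamma>(1+2n)\<close>.\<close>

lemma dual_term_telescope:
  assumes "Re n \<ge> -1/4" "k > 0"
  defines "D \<equiv> \<lambda>k. shift_prod k n / (of_nat k * (of_nat k + 1 + 2 * n))"
  shows "dual_term (Suc k) n + (1 + n) / (2 * (1 + 2 * n)) * dual_term k (n + 1) = (D k - D (Suc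
      k)) / (2 + 2 * n)"
proof -
  have nz: "of_nat k + 1 + 2 * n \<noteq> 0" "of_nat k + 2 + 2 * n \<noteq> 0" "of_nat k + 1 + n
      \<noteq> 0"
    "1 + 2 * n \<noteq> 0" "1 + n \<noteq> 0" "of_nat k \<noteq> (0::complex)" "2 + 2 * n \<noteq>
        0" "of_nat k + 1 \<noteq> (0::complex)"
    by (intro nonzero_of_Re_pos; use assms in simp)+
  define Q K where "Q = shift_prod k n" and "K = (of_nat k :: complex)"
  have v1: "dual_term (Suc k) n = Q * K / (K * (K + 1 + 2 * n) * (K + 1 + n)^2)"
    using nz by (simp add: dual_term_def shift_prod_Suc Q_def K_def divide_simps add_ac)
  have v2: "(1 + n) / (2 * (1 + 2 * n)) * dual_term k (n + 1) =
     Q * (1 + n)^2 / (K * (K + 1 + 2 * n) * (K + 2 + 2 * n) * (K + 1 + n)^2)"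
    unfolding Q_def K_def by (rule dual_term_plus1[OF assms(1)])
  have d: "D k = Q / (K * (K + 1 + 2 * n))" "D (Suc k) = Q / ((K + 1 + 2 * n) * (K + 2 + 2 * n))"
    using nz by (auto simp: D_def Q_def K_def shift_prod_Suc divide_simps add_ac)
  have nzK: "K + 1 + 2 * n \<noteq> 0" "K + 2 + 2 * n \<noteq> 0" "K + 1 + n \<noteq> 0" "K
      \<noteq> 0"
    using nz by (simp_all add: K_def)
  \<comment> \<open>Over the common denominator the two numerators add up to a perfect square, which
    cancels the squared factor and leaves a telescoping summand.\<close>
  have "K * (K + 2 + 2 * n) + (1 + n)^2 = (K + 1 + n)^2"
    by (simp add: power2_eq_square algebra_simps)
  have "dual_term (Suc k) n + (1 + n) / (2 * (1 + 2 * n)) * dual_term k (n + 1) =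
     Q * (K * (K + 2 + 2 * n) + (1 + n)^2) / (K * (K + 1 + 2 * n) * (K + 2 + 2 * n) * (K + 1 +
         n)^2)"
    unfolding v1 v2 using nzK by (simp add: divide_simps) (simp add: algebra_simps)
  also have "K * (K + 2 + 2 * n) + (1 + n)^2 = (K + 1 + n)^2" by fact
  also have "Q * (K + 1 + n)^2 / (K * (K + 1 + 2 * n) * (K + 2 + 2 * n) * (K + 1 + n)^2) =
     Q / (K * (K + 1 + 2 * n) * (K + 2 + 2 * n))"
    using nzK by simp
  also have "\<dots> = (D k - D (Suc k)) / (2 + 2 * n)"
    unfolding d using nzK nz(7) by (simp add: divide_simps) (simp add: algebra_simps)
  finally show ?thesis .
qed

text \<open>The index offset between the two series leaves \<open>dual_term 1 n\<close> unpaired,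
  and telescoping leaves \<open>D 1 / (2 + 2 * n)\<close>. Over the common denominator they
  contribute 4 and 1 to the numerator 5.\<close>

lemma dual_series_plus1:
  assumes "Re n \<ge> -1/4"
  shows "dual_series n + (1 + n) / (2 * (1 + 2 * n)) * dual_series (n + 1) = 5 / (4 * (n + 1) ^ 2
      * (2 * n + 1))"
proof -
  have nz: "1 + 2 * n \<noteq> 0" "1 + n \<noteq> 0" "2 + 2 * n \<noteq> 0"
    by (intro nonzero_of_Re_pos; use assms in simp)+
  define D where "D = (\<lambda>k. shift_prod k n / (of_nat k * (of_nat k + 1 + 2 * n)))"
  have "(\<lambda>k. norm (D (Suc k))) \<longlonglongrightarrow> 0"
  proof (rule tendsto_sandwich[OF _ _ tendsto_const])
    show "(\<lambda>k. 3 / real (Suc k)) \<longlonglongrightarrow> 0" by real_asymp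
    show "\<forall>\<^sub>F k in sequentially. norm (D (Suc k)) \<le> 3 / real (Suc k)"
    proof (intro always_eventually allI)
      fix k
      have "real (Suc k) \<le> Re (of_nat (Suc k) + 1 + 2 * n)" using assms by simp
      hence le: "real (Suc k) \<le> norm (of_nat (Suc k) + 1 + 2 * n)"
        using complex_Re_le_cmod order.trans by blast
      have "norm (D (Suc k)) = norm (shift_prod (Suc k) n) / (real (Suc k) * norm (of_nat (Suc k)
          + 1 + 2 * n))"
        unfolding D_def norm_divide norm_mult norm_of_nat ..
      also have "\<dots> \<le> (3 * real (Suc k)) / (real (Suc k) * real (Suc k))"
        using norm_shift_prod_le[OF assms, of "Suc k"] le by (intro frac_le mult_left_mono) auto
      also have "\<dots> = 3 / real (Suc k)" by (simp add: divide_simps del: of_nat_Suc)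
      finally show "norm (D (Suc k)) \<le> 3 / real (Suc k)" .
    qed
  qed auto
  hence "(\<lambda>k. D (Suc k)) \<longlonglongrightarrow> 0" by (rule tendsto_norm_zero_cancel)
  hence "(\<lambda>k. D (Suc k) - D (Suc (Suc k))) sums (D (Suc 0) - 0)"
    by (rule telescope_sums')
  hence "(\<lambda>k. (D (Suc k) - D (Suc (Suc k))) / (2 + 2 * n)) sums ((D 1 - 0) / (2 + 2 * n))"
    by (intro sums_divide) simp
  moreover have "(\<lambda>k. dual_term (Suc (Suc k)) n + (1 + n) / (2 * (1 + 2 * n)) * dual_term
      (Suc k) (n + 1)) sums
    ((dual_series n - dual_term 1 n) + (1 + n) / (2 * (1 + 2 * n)) * dual_series (n + 1))"
  proof (intro sums_add sums_mult dual_term_sums)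
    show "(\<lambda>k. dual_term (Suc (Suc k)) n) sums (dual_series n - dual_term 1 n)"
      using dual_term_sums[OF assms] by (subst sums_Suc_iff) simp
  qed (use assms in auto)
  ultimately have "(dual_series n - dual_term 1 n) + (1 + n) / (2 * (1 + 2 * n)) * dual_series (n
      + 1) = (D 1 - 0) / (2 + 2 * n)"
    using dual_term_telescope[OF assms, of "Suc k" for k] unfolding D_def[symmetric]
    by (intro sums_unique2) (auto simp: D_def)
  hence "dual_series n + (1 + n) / (2 * (1 + 2 * n)) * dual_series (n + 1) = dual_term 1 n + D 1 /
      (2 + 2 * n)"
    by (simp add: algebra_simps)
  also have "dual_term 1 n = 1 / ((1 + 2 * n) * (1 + n) ^ 2)"
    by (simp add: dual_term_def shift_prod_def)
  also have "D 1 = 1 / ((1 + 2 * n) * (2 + 2 * n))"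
    by (simp add: D_def shift_prod_def)
  also have "2 + 2 * n = 2 * (1 + n)" by simp
  also have "1 / ((1 + 2 * n) * (1 + n) ^ 2) + 1 / ((1 + 2 * n) * (2 * (1 + n))) / (2 * (1 + n)) =
     5 / (4 * (n + 1) ^ 2 * (2 * n + 1))"
  proof -
    define a b where "a = 1 + n" and "b = 1 + 2 * n"
    have "a \<noteq> 0" "b \<noteq> 0" "n + 1 = a" "2 * n + 1 = b" using nz by (auto simp: a_def
        b_def)
    thus ?thesis unfolding a_def[symmetric] b_def[symmetric]
      by (simp add: divide_simps power2_eq_square)
  qed
  finally show ?thesis .
qed

definition central_term :: "complex \<Rightarrow> complex" where
  "central_term z = Gamma (z + 1) ^ 2 / (z ^ 3 * Gamma (2 * z + 1))"

lemma central_term_plus1: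
  assumes "Re n \<ge> -1/4"
  shows "central_term (n + 1) = gamma_quot n / (2 * (n + 1) ^ 2 * (2 * n + 1))"
proof -
  have nz: "1 + 2 * n \<noteq> 0" "1 + n \<noteq> 0"
    by (intro nonzero_of_Re_pos; use assms in simp)+
  have "central_term (n + 1) = gamma_quot (n + 1) / (n + 1) ^ 3"
    by (simp add: central_term_def gamma_quot_def add_ac)
  also have "\<dots> = gamma_quot n * ((1 + n) / (2 * (1 + 2 * n))) / (n + 1) ^ 3"
    by (simp only: gamma_quot_plus1[OF assms])
  also have "\<dots> = gamma_quot n / (2 * (n + 1) ^ 2 * (2 * n + 1))"
  proof -
    define a b where "a = 1 + n" and "b = 1 + 2 * n"
    have "a \<noteq> 0" "b \<noteq> 0" "n + 1 = a" "2 * n + 1 = b" using nz by (auto simp: a_def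
        b_def)
    thus ?thesis unfolding a_def[symmetric] b_def[symmetric]
      by (simp add: divide_simps power2_eq_square power3_eq_cube)
  qed
  finally show ?thesis .
qed

text \<open>Multiplying by \<open>gamma_quot\<close> absorbs the rational coefficient of the shifted
  series, and the inhomogeneous term becomes a multiple of the summand of the original
  series.\<close>

lemma gamma_quot_dual_series_recurrence:
  assumes "Re n \<ge> -1/4"
  shows "gamma_quot n * dual_series n = 5 / 2 * central_term (n + 1) - gamma_quot (n + 1) *
      dual_series (n + 1)"
proof -
  have "gamma_quot n * dual_series n + gamma_quot (n + 1) * dual_series (n + 1) =
      gamma_quot n * (dual_series n + (1 + n) / (2 * (1 + 2 * n)) * dual_series (n + 1))"
    unfolding gamma_quot_plus1[OF assms] by (simp only: distrib_left mult.assoc)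
  also have "\<dots> = 5 / 2 * central_term (n + 1)"
    unfolding dual_series_plus1[OF assms] central_term_plus1[OF assms] by (simp add: mult_ac)
  finally show ?thesis by (simp add: algebra_simps)
qed

text \<open>Adding a positive real to a number with nonnegative real part increases its modulus;
  this makes each of the two linear denominators at least twice as large as 1 + n. The rate 1/4 is
  uniform in k, so the remainder of the iterated recurrence decays geometrically.\<close>

lemma norm_gamma_quot_dual_term_plus1_le:
  assumes "Re n \<ge> -1/4"
  shows "norm (gamma_quot (n + 1) * dual_term (Suc k) (n + 1)) \<le> 1/4 * norm (gamma_quot n *
      dual_term (Suc k) n)"
proof -
  define K :: complex where "K = of_nat (Suc k)"
  define q where "q = (1 + n)^2 * (K + n)^2 / ((K + 1 + 2 * n) * (K + 2 + 2 * n) * (K + 1 + n)^2)"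
  have nz: "K + n \<noteq> 0" "K + 1 + 2 * n \<noteq> 0" "K + 2 + 2 * n \<noteq> 0" "K + 1 + n
      \<noteq> 0" "K \<noteq> 0"
    by (intro nonzero_of_Re_pos; use assms in \<open>simp add: K_def\<close>)+
  have "gamma_quot (n + 1) * dual_term (Suc k) (n + 1) = gamma_quot n * ((1 + n) / (2 * (1 + 2 *
      n)) * dual_term (Suc k) (n + 1))"
    unfolding gamma_quot_plus1[OF assms] by (simp only: mult.assoc)
  also have "(1 + n) / (2 * (1 + 2 * n)) * dual_term (Suc k) (n + 1) =
      shift_prod (Suc k) n * (1 + n)^2 / (K * (K + 1 + 2 * n) * (K + 2 + 2 * n) * (K + 1 + n)^2)"
    unfolding K_def by (rule dual_term_plus1[OF assms])
  also have "\<dots> = dual_term (Suc k) n * q"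
    unfolding dual_term_def q_def K_def[symmetric] using nz by simp
  finally have eq: "gamma_quot (n + 1) * dual_term (Suc k) (n + 1) = gamma_quot n * dual_term (Suc
      k) n * q" by simp
  have 1: "2 * norm (1 + n) \<le> norm (K + 1 + 2 * n)"
    using norm_le_norm_add_of_real[of "2 + 2 * n" "real k"] assms norm_mult[of 2 "1 + n"]
    by (simp add: K_def algebra_simps)
  have 2: "2 * norm (1 + n) \<le> norm (K + 2 + 2 * n)"
    using norm_le_norm_add_of_real[of "2 + 2 * n" "real (Suc k)"] assms norm_mult[of 2 "1 + n"]
    by (simp add: K_def algebra_simps)
  have 3: "norm (K + n) \<le> norm (K + 1 + n)"
    using norm_le_norm_add_of_real[of "K + n" 1] assms by (simp add: K_def algebra_simps)
  have "4 * norm (1 + n)^2 * norm (K + n)^2 = (2 * norm (1 + n)) * (2 * norm (1 + n)) * norm (K +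
      n)^2"
    by (simp add: power2_eq_square)
  also have "\<dots> \<le> norm (K + 1 + 2 * n) * norm (K + 2 + 2 * n) * norm (K + 1 + n)^2"
    by (intro mult_mono power_mono 1 2 3) auto
  finally have "norm q \<le> 1/4"
    using nz by (simp add: q_def norm_mult norm_divide norm_power divide_simps)
  hence "norm (gamma_quot n * dual_term (Suc k) n) * norm q \<le> norm (gamma_quot n * dual_term
      (Suc k) n) * (1/4)"
    by (intro mult_left_mono) auto
  thus ?thesis unfolding eq norm_mult by (simp add: mult_ac)
qed

lemma norm_central_term_plus1_le:
  assumes "Re z \<ge> 3/4"
  shows "norm (central_term (z + 1)) \<le> 1/4 * norm (central_term z)"
proof -
  have nz: "z \<noteq> 0" "z + 1 \<noteq> 0" "2 * z + 1 \<noteq> 0"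
    by (intro nonzero_of_Re_pos; use assms in simp)+
  have "central_term z = gamma_quot z / z ^ 3"
    by (simp add: central_term_def gamma_quot_def add_ac)
  moreover have "central_term (z + 1) = gamma_quot z / (2 * (z + 1) ^ 2 * (2 * z + 1))"
    using assms by (intro central_term_plus1) auto
  ultimately have "central_term (z + 1) = central_term z * (z ^ 3 / (2 * (z + 1) ^ 2 * (2 * z +
      1)))"
    using nz by simp
  moreover have "norm (z ^ 3 / (2 * (z + 1) ^ 2 * (2 * z + 1))) \<le> 1/4"
  proof -
    have 1: "norm z \<le> norm (z + 1)"
      using norm_le_norm_add_of_real[of z 1] assms by (simp add: add_ac)
    have 2: "2 * norm z \<le> norm (2 * z + 1)"
      using norm_le_norm_add_of_real[of "2 * z" 1] assms by (simp add: add_ac norm_mult)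
    have "4 * norm z ^ 3 = 2 * norm z ^ 2 * (2 * norm z)"
      by (simp add: power2_eq_square power3_eq_cube)
    also have "\<dots> \<le> 2 * norm (z + 1) ^ 2 * norm (2 * z + 1)"
      by (intro mult_mono power_mono 1 2) auto
    finally show ?thesis
      using nz by (simp add: norm_mult norm_divide norm_power divide_simps)
  qed
  ultimately have "norm (central_term (z + 1)) \<le> norm (central_term z) * (1/4)"
    by (simp only: norm_mult) (intro mult_left_mono; simp)
  thus ?thesis by simp
qed

lemma Re_cball_quarter: "norm z \<le> 1/4 \<Longrightarrow> Re z \<ge> -1/4"
  using abs_Re_le_cmod[of z] by linarith

text \<open>Iterating the recurrence M times gives 5/2 times a partial sum plus a remainder at z +
  M. The termwise bounds dominate this remainder by (1/4)^M times a convergent sum.\<close>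

lemma central_term_alternating_sums:
  assumes "Re z \<ge> -1/4"
  shows "(\<lambda>k. (-1) ^ k * central_term (z + of_nat k + 1)) sums (2 / 5 * gamma_quot z *
      dual_series z)"
proof -
  have iter: "gamma_quot z * dual_series z = 5 / 2 * (\<Sum>k<M. (-1) ^ k * central_term (z +
      of_nat k + 1)) +
      (-1) ^ M * (gamma_quot (z + of_nat M) * dual_series (z + of_nat M))" for M
  proof (induction M)
    case (Suc M)
    have "Re (z + of_nat M) \<ge> -1/4" using assms by simp
    note rec = gamma_quot_dual_series_recurrence[OF this]
    show ?case
      unfolding Suc rec by (simp add: algebra_simps)
  qed auto
  have bound: "norm (gamma_quot (z + of_nat M) * dual_term (Suc k) (z + of_nat M)) \<le>
      (1/4) ^ M * norm (gamma_quot z * dual_term (Suc k) z)" for M k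
  proof (induction M)
    case (Suc M)
    have "Re (z + of_nat M) \<ge> -1/4" using assms by simp
    from norm_gamma_quot_dual_term_plus1_le[OF this, of k] Suc show ?case by (simp add: add_ac)
  qed auto
  define C where "C = (\<Sum>k. norm (gamma_quot z) * (6 / real (Suc k) ^ 2))"
  have sm: "summable (\<lambda>k. norm (gamma_quot z) * (6 / real (Suc k) ^ 2))"
    by (intro summable_mult summable_inverse_squares)
  have bound2: "norm (gamma_quot (z + of_nat M) * dual_series (z + of_nat M)) \<le> (1/4) ^ M * C"
      for M
  proof -
    have "(\<lambda>k. gamma_quot (z + of_nat M) * dual_term (Suc k) (z + of_nat M)) sums
        (gamma_quot (z + of_nat M) * dual_series (z + of_nat M))"
      using assms by (intro sums_mult dual_term_sums) simp
    moreover have "(\<lambda>k. (1/4) ^ M * (norm (gamma_quot z) * (6 / real (Suc k) ^ 2))) sums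
        ((1/4) ^ M * C)"
      unfolding C_def by (intro sums_mult summable_sums sm)
    moreover have "norm (gamma_quot (z + of_nat M) * dual_term (Suc k) (z + of_nat M)) \<le> (1/4)
        ^ M * (norm (gamma_quot z) * (6 / real (Suc k) ^ 2))" for k
      by (rule order.trans[OF bound], unfold norm_mult) (intro mult_left_mono
          norm_dual_term_Suc_le assms; simp)
    ultimately show ?thesis by (metis (no_types, lifting) norm_suminf_le sums_iff)
  qed
  have "(\<lambda>M. (-1) ^ M * (gamma_quot (z + of_nat M) * dual_series (z + of_nat M)))
      \<longlonglongrightarrow> 0"
  proof (rule Lim_null_comparison)
    show "\<forall>\<^sub>F M in sequentially. norm ((-1) ^ M * (gamma_quot (z + of_nat M) *
        dual_series (z + of_nat M))) \<le> (1/4) ^ M * C"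
      using bound2 by (simp add: norm_mult norm_power)
    show "(\<lambda>M. (1/4) ^ M * C) \<longlonglongrightarrow> 0"
      by (intro tendsto_mult_left_zero LIMSEQ_realpow_zero) auto
  qed
  hence "(\<lambda>M. 2 / 5 * (gamma_quot z * dual_series z - (-1) ^ M * (gamma_quot (z + of_nat
      M) * dual_series (z + of_nat M)))) \<longlonglongrightarrow>
      2 / 5 * (gamma_quot z * dual_series z - 0)"
    by (intro tendsto_intros)
  moreover have "2 / 5 * (gamma_quot z * dual_series z - (-1) ^ M * (gamma_quot (z + of_nat M) *
      dual_series (z + of_nat M))) =
      (\<Sum>k<M. (-1) ^ k * central_term (z + of_nat k + 1))" for M
    using iter[of M] by simp
  ultimately show ?thesis unfolding sums_def by (simp add: mult.assoc)
qed

section \<open>Taylor coefficients of the dual series\<close>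

lemma higher_deriv_sum_at:
  assumes "open A" "z \<in> A" "\<And>k. f k holomorphic_on A"
  shows "(deriv ^^ m) (\<lambda>z. \<Sum>k<(N::nat). f k z) z = (\<Sum>k<N. (deriv ^^ m) (f k) z)"
proof (induction N)
  case (Suc N)
  have "(deriv ^^ m) (\<lambda>w. (\<Sum>k<N. f k w) + f N w) z = (deriv ^^ m) (\<lambda>z.
      \<Sum>k<N. f k z) z + (deriv ^^ m) (f N) z"
    by (rule higher_deriv_add[OF _ _ assms(1,2)]) (use assms in \<open>auto intro!:
        holomorphic_intros\<close>)
  thus ?case using Suc by simp
qed (simp add: higher_deriv_const)

text \<open>Weierstrass: a dominated series of holomorphic functions may be differentiated termwise.
  This serves both the Taylor coefficients of \<open>dual_series\<close> and the derivatives of the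
  original summands.\<close>

lemma higher_deriv_series_sums:
  fixes f :: "nat \<Rightarrow> complex \<Rightarrow> complex"
  assumes A: "open A" "z \<in> A" and holo: "\<And>k. f k holomorphic_on A"
    and M: "\<And>k z. z \<in> A \<Longrightarrow> norm (f k z) \<le> M k" "summable M"
    and g: "\<And>z. z \<in> A \<Longrightarrow> (\<lambda>k. f k z) sums g z"
  shows "(\<lambda>k. (deriv ^^ m) (f k) z) sums (deriv ^^ m) g z" "g holomorphic_on A"
proof -
  have ul: "uniform_limit A (\<lambda>N z. \<Sum>k<N. f k z) (\<lambda>z. \<Sum>k. f k z)
      sequentially"
    using M by (intro Weierstrass_m_test) auto
  have ul: "uniform_limit A (\<lambda>N z. \<Sum>k<N. f k z) g sequentially"
    by (rule uniform_limit_cong'[THEN iffD1, OF _ _ ul]) (use g in \<open>auto simp: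
        sums_iff\<close>)
  have "(\<lambda>N. (deriv ^^ m) (\<lambda>z. \<Sum>k<N. f k z) z) \<longlonglongrightarrow>
      (deriv ^^ m) g z"
    by (rule higher_deriv_complex_uniform_limit[OF ul])
       (use A holo in \<open>auto intro!: holomorphic_intros always_eventually\<close>)
  thus "(\<lambda>k. (deriv ^^ m) (f k) z) sums (deriv ^^ m) g z"
    unfolding sums_def higher_deriv_sum_at[OF A holo] .
  show "g holomorphic_on A"
  proof (rule holomorphic_uniform_sequence[OF A(1)])
    fix n show "(\<lambda>z. \<Sum>k<n. f k z) holomorphic_on A" using holo by (intro
        holomorphic_intros)
  next
    fix x assume "x \<in> A"
    then obtain d where "d > 0" "cball x d \<subseteq> A" using A(1) open_contains_cball by blast
    thus "\<exists>d. 0 < d \<and> cball x d \<subseteq> A \<and> uniform_limit (cball x d)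
        (\<lambda>n z. \<Sum>k<n. f k z) g sequentially"
      using uniform_limit_on_subset[OF ul] by blast
  qed
qed

text \<open>The complete homogeneous symmetric polynomial of degree b in 1, 1/2, ..., 1/k. Its
  generating function is the product of 1 / (1 - x/j) over j up to k, which at x = -2z is
  \<open>shift_prod k z\<close>.\<close>

definition star_sum :: "nat \<Rightarrow> nat \<Rightarrow> real" where
  "star_sum b k = (\<Sum>m\<le>k. \<Sum>w\<leftarrow>y_words b. mzv_coeff w m)"

text \<open>A leading \<open>X\<close> keeps the next index equal to k and a leading
  \<open>Y\<close> makes it smaller; together they give the sum over all m up to k.\<close>

lemma y_words_mzv_coeff_Suc: "(\<Sum>w\<leftarrow>y_words (Suc b). mzv_coeff w k) = star_sum b k /
    real k"
proof (cases b)
  case 0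
  thus ?thesis by (cases "k = 0") (auto simp: star_sum_def sum.delta)
next
  case (Suc c)
  have "(\<Sum>w\<leftarrow>y_words (Suc b). mzv_coeff w k) = (\<Sum>w\<leftarrow>y_words b.
      mzv_coeff w k / real k) + (\<Sum>w\<leftarrow>y_words b. (\<Sum>m<k. mzv_coeff w m) / real k)"
    by (simp add: Suc comp_def)
  also have "\<dots> = ((\<Sum>w\<leftarrow>y_words b. mzv_coeff w k) + (\<Sum>m<k.
      \<Sum>w\<leftarrow>y_words b. mzv_coeff w m)) / real k"
    by (simp only: sum_list_divide[symmetric] sum_list_swap add_divide_distrib)
  also have "\<dots> = star_sum b k / real k"
    by (simp add: star_sum_def lessThan_Suc_atMost[symmetric])
  finally show ?thesis .
qed

lemma star_sum_0: "star_sum 0 k = 1"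
  by (simp add: star_sum_def sum.delta)

lemma star_sum_Suc_0: "star_sum (Suc b) 0 = 0"
  using y_words_mzv_coeff_Suc[where b = b and k = 0] by (simp add: star_sum_def)

lemma star_sum_Suc_Suc: "star_sum (Suc b) (Suc k) = star_sum (Suc b) k + star_sum b (Suc k) / real
    (Suc k)"
  using y_words_mzv_coeff_Suc[where b = b and k = "Suc k"] by (simp add: star_sum_def)

definition shift_prod_fps :: "nat \<Rightarrow> complex fps" where
  "shift_prod_fps k = Abs_fps (\<lambda>b. (-2) ^ b * of_real (star_sum b k))"

lemma shift_prod_fps_0: "shift_prod_fps 0 = 1"
proof (rule fps_ext)
  fix n show "fps_nth (shift_prod_fps 0) n = fps_nth 1 n"
    by (cases n) (auto simp: shift_prod_fps_def star_sum_0 star_sum_Suc_0)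
qed

lemma shift_prod_fps_Suc: "(1 + fps_const (2 / of_nat (Suc k)) * fps_X) * shift_prod_fps (Suc k) =
    shift_prod_fps k"
proof (rule fps_ext)
  fix n show "fps_nth ((1 + fps_const (2 / of_nat (Suc k)) * fps_X) * shift_prod_fps (Suc k)) n =
      fps_nth (shift_prod_fps k) n"
    by (cases n) (auto simp: shift_prod_fps_def star_sum_0 star_sum_Suc_Suc distrib_right
        mult.assoc ring_distribs simp del: of_nat_Suc)
qed

lemma shift_prod_has_fps_expansion: "shift_prod k has_fps_expansion shift_prod_fps k"
proof (induction k)
  case 0
  have "shift_prod 0 = (\<lambda>_. 1)" by auto
  thus ?case by (simp add: shift_prod_fps_0)
next
  case (Suc k)
  let ?D = "1 + fps_const (2 / of_nat (Suc k)) * fps_X :: complex fps"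
  have D0: "fps_nth ?D 0 \<noteq> 0" by simp
  have "(\<lambda>z. shift_prod k z * inverse (1 + 2 / of_nat (Suc k) * z)) has_fps_expansion
      shift_prod_fps k * inverse ?D"
    by (intro has_fps_expansion_mult has_fps_expansion_inverse has_fps_expansion_add
        has_fps_expansion_1
          has_fps_expansion_cmult_left has_fps_expansion_fps_X Suc D0)
  also have "shift_prod_fps k * inverse ?D = shift_prod_fps (Suc k)"
  proof -
    have "shift_prod_fps k * inverse ?D = (inverse ?D * ?D) * shift_prod_fps (Suc k)"
      by (subst shift_prod_fps_Suc[symmetric]) (simp only: mult_ac)
    thus ?thesis unfolding inverse_mult_eq_1[OF D0] by simp
  qed
  also have "(\<lambda>z. shift_prod k z * inverse (1 + 2 / of_nat (Suc k) * z)) = shift_prod (Suc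
      k)"
  proof
    fix z :: complex
    have "1 + 2 / of_nat (Suc k) * z = (of_nat (Suc k) + 2 * z) / of_nat (Suc k)"
      by (simp add: add_divide_distrib del: of_nat_Suc)
    thus "shift_prod k z * inverse (1 + 2 / of_nat (Suc k) * z) = shift_prod (Suc k) z"
      unfolding shift_prod_Suc by simp
  qed
  finally show ?case .
qed

lemma inverse_square_fps:
  assumes "k > 0"
  shows "inverse ((fps_const (of_nat k) + fps_X)\<^sup>2) = Abs_fps (\<lambda>a. (-1) ^ a * of_nat
      (Suc a) / of_nat k ^ (a + 2) :: complex)"
proof (rule fps_inverse_unique)
  let ?L = "fps_const (of_nat k) + fps_X :: complex fps"
  let ?A1 = "Abs_fps (\<lambda>a. (-1) ^ a / of_nat k ^ (a + 1) :: complex)"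
  let ?A2 = "Abs_fps (\<lambda>a. (-1) ^ a * of_nat (Suc a) / of_nat k ^ (a + 2) :: complex)"
  have 1: "?L * ?A1 = 1"
  proof (rule fps_ext)
    fix n show "fps_nth (?L * ?A1) n = fps_nth 1 n"
      using assms by (cases n) (auto simp: distrib_right)
  qed
  have 2: "?L * ?A2 = ?A1"
  proof (rule fps_ext)
    fix n show "fps_nth (?L * ?A2) n = fps_nth ?A1 n"
      using assms by (cases n) (auto simp: distrib_right field_simps power2_eq_square)
  qed
  show "?L\<^sup>2 * ?A2 = 1"
    unfolding power2_eq_square mult.assoc 2 1 ..
qed

definition dual_coeff :: "nat \<Rightarrow> nat \<Rightarrow> real" where
  "dual_coeff m k = (\<Sum>(c, ws)\<leftarrow>dual_words m. of_int c * (\<Sum>w\<leftarrow>ws.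
      mzv_coeff w k))"

lemma dual_coeff_eq:
  "dual_coeff m k = (\<Sum>a=0..m. (-1) ^ m * (real a + 1) * 2 ^ (m - a) * (star_sum (m - a) k /
      real k / real k ^ (a + 2)))"
proof -
  have "dual_coeff m k = (\<Sum>a\<leftarrow>[0..<Suc m]. (-1) ^ m * (real a + 1) * 2 ^ (m - a) *
      (\<Sum>w\<leftarrow>y_words (Suc (m - a)). mzv_coeff w k / real k ^ (a + 2)))"
    unfolding dual_coeff_def dual_words_def
    by (simp add: comp_def mzv_coeff_replicate_X[of "Suc (Suc _)", simplified] del: upt_Suc
        y_words.simps)
  also have "\<dots> = (\<Sum>a\<leftarrow>[0..<Suc m]. (-1) ^ m * (real a + 1) * 2 ^ (m - a) *
      (star_sum (m - a) k / real k / real k ^ (a + 2)))"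
    unfolding sum_list_divide[symmetric] y_words_mzv_coeff_Suc ..
  also have "\<dots> = (\<Sum>a=0..m. (-1) ^ m * (real a + 1) * 2 ^ (m - a) * (star_sum (m - a) k
      / real k / real k ^ (a + 2)))"
    unfolding interv_sum_list_conv_sum_set_nat set_upt atLeastLessThanSuc_atLeastAtMost ..
  finally show ?thesis .
qed

lemma dual_term_fps:
  assumes "k > 0"
  shows "dual_term k has_fps_expansion Abs_fps (\<lambda>m. of_real (dual_coeff m k))"
proof -
  let ?L = "fps_const (of_nat k) + fps_X :: complex fps"
  let ?F = "fps_const (1 / of_nat k) * (inverse (?L\<^sup>2) * shift_prod_fps k)"
  have "(\<lambda>z. (1 / of_nat k) * (inverse ((of_nat k + z)\<^sup>2) * shift_prod k z))
      has_fps_expansion ?F"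
    unfolding power2_eq_square
    by (intro has_fps_expansion_cmult_left has_fps_expansion_mult has_fps_expansion_inverse
        has_fps_expansion_add
          has_fps_expansion_const has_fps_expansion_fps_X shift_prod_has_fps_expansion) (use assms
              in auto)
  also have "(\<lambda>z. (1 / of_nat k) * (inverse ((of_nat k + z)\<^sup>2) * shift_prod k z)) =
      dual_term k"
    by (auto simp: dual_term_def divide_simps)
  also have "?F = Abs_fps (\<lambda>m. of_real (dual_coeff m k))"
  proof (rule fps_ext)
    fix m
    have "fps_nth ?F m = (\<Sum>a=0..m. 1 / of_nat k * ((-1) ^ a * of_nat (Suc a) / of_nat k ^ (a
        + 2) * ((-2) ^ (m - a) * of_real (star_sum (m - a) k))))"
      unfolding inverse_square_fps[OF assms] shift_prod_fps_def
      by (subst fps_mult_left_const_nth) (simp only: fps_mult_nth fps_nth_Abs_fps sum_distrib_left)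
    also have "\<dots> = of_real (dual_coeff m k)"
      unfolding dual_coeff_eq of_real_sum
    proof (intro sum.cong refl)
      fix a assume a: "a \<in> {0..m}"
      have "(-1) ^ a * (-2) ^ (m - a) = (-1) ^ m * (2 :: complex) ^ (m - a)"
        using a by (simp add: power_minus[of 2] flip: power_add mult.assoc)
      hence eq: "(-2) ^ (m - a) * (-1) ^ a = (-1) ^ m * (2 :: complex) ^ (m - a)" by (simp add:
          mult.commute)
      have "1 / of_nat k * ((-1) ^ a * of_nat (Suc a) / of_nat k ^ (a + 2) * ((-2) ^ (m - a) *
          of_real (star_sum (m - a) k))) =
          ((-2) ^ (m - a) * (-1) ^ a) * of_nat (Suc a) * (of_real (star_sum (m - a) k) / of_nat k
              / of_nat k ^ (a + 2) :: complex)"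
        by (simp add: mult_ac)
      also have "\<dots> = of_real ((-1) ^ m * (real a + 1) * 2 ^ (m - a) * (star_sum (m - a) k /
          real k / real k ^ (a + 2)))"
        unfolding eq by (simp add: add_ac mult_ac)
      finally show "1 / of_nat k * ((-1) ^ a * of_nat (Suc a) / of_nat k ^ (a + 2) * ((-2) ^ (m -
          a) * of_real (star_sum (m - a) k))) = \<dots>" .
    qed
    finally show "fps_nth ?F m = fps_nth (Abs_fps (\<lambda>m. complex_of_real (dual_coeff m k)))
        m" by simp
  qed
  finally show ?thesis .
qed

definition dual_mzv :: "nat \<Rightarrow> real" where
  "dual_mzv m = trie_eval mzv (combination_trie (dual_words m))"

lemma dual_coeff_sums: "dual_coeff m sums dual_mzv m"
proof -
  have "dual_coeff m = (\<lambda>k. \<Sum>x\<leftarrow>dual_words m. of_int (fst x) *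
      (\<Sum>w\<leftarrow>snd x. mzv_coeff w k))"
    by (auto simp: dual_coeff_def case_prod_unfold)
  also have "\<dots> sums (\<Sum>x\<leftarrow>dual_words m. of_int (fst x) *
      (\<Sum>w\<leftarrow>snd x. mzv w))"
    by (intro sums_sum_list sums_mult admissible_sums) (auto simp: dual_words_def)
  finally show ?thesis by (simp add: dual_mzv_def trie_eval_combination case_prod_unfold)
qed

lemma dual_coeff_0 [simp]: "dual_coeff m 0 = 0"
  by (simp add: dual_coeff_eq)

lemma dual_term_holomorphic: "dual_term (Suc k) holomorphic_on {z. Re z > -1/4}"
proof -
  have "of_nat j + 2 * z \<noteq> 0" if "Re z > -1/4" "j \<in> {1..Suc k}" for z and j :: nat
    by (rule nonzero_of_Re_pos) (use that in auto)
  moreover have "of_nat (Suc k) + z \<noteq> 0" if "Re z > -1/4" for z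
    by (rule nonzero_of_Re_pos) (use that in auto)
  ultimately show ?thesis unfolding dual_term_def shift_prod_def
    by (intro holomorphic_intros) (auto simp del: of_nat_Suc)
qed

lemma dual_series_has_fps_expansion: "dual_series has_fps_expansion Abs_fps (\<lambda>m. of_real
    (dual_mzv m))"
proof -
  let ?A = "{z. Re z > -1/4}"
  have A: "open ?A" "(0::complex) \<in> ?A" by (auto simp: open_halfspace_Re_gt)
  have M: "norm (dual_term (Suc k) z) \<le> 6 / real (Suc k) ^ 2" if "z \<in> ?A" for k z
    using that by (intro norm_dual_term_Suc_le) auto
  have S: "(\<lambda>k. dual_term (Suc k) z) sums dual_series z" if "z \<in> ?A" for z
    using that by (intro dual_term_sums) auto
  note D = higher_deriv_series_sums[OF A dual_term_holomorphic M summable_inverse_squares S]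
  have "dual_series has_fps_expansion fps_expansion dual_series 0"
    using D(2) A by (intro has_fps_expansion_fps_expansion[of ?A]) auto
  also have "fps_expansion dual_series 0 = Abs_fps (\<lambda>m. of_real (dual_mzv m))"
  proof (rule fps_ext)
    fix m
    have "(\<lambda>k. (deriv ^^ m) (dual_term (Suc k)) 0 / fact m) sums ((deriv ^^ m) dual_series
        0 / fact m)"
      by (intro sums_divide D(1))
    moreover have "(deriv ^^ m) (dual_term (Suc k)) 0 / fact m = of_real (dual_coeff m (Suc k))"
        for k
      using fps_nth_fps_expansion[OF dual_term_fps[of "Suc k"], of m] by simp
    moreover have "(\<lambda>k. complex_of_real (dual_coeff m (Suc k))) sums of_real (dual_mzv m)"
      using dual_coeff_sums[of m] by (subst sums_of_real_iff, subst sums_Suc_iff) simp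
    ultimately have "(deriv ^^ m) dual_series 0 / fact m = of_real (dual_mzv m)"
      using sums_unique2 by simp
    thus "fps_nth (fps_expansion dual_series 0) m = fps_nth (Abs_fps (\<lambda>m. complex_of_real
        (dual_mzv m))) m"
      by (simp add: fps_expansion_def)
  qed
  finally show ?thesis .
qed

section \<open>Derivatives of the central binomial series\<close>

lemma mzv_coeff_singleton: "mzv_coeff (word [k]) n = (if n = 0 then 0 else 1 / real n ^ k)" if "k
    > 0"
  using that by (subst mzv_coeff_word_Cons) (auto simp: sum.delta)

lemma mzv_singleton_sums: "k > 1 \<Longrightarrow> (\<lambda>n. 1 / real (Suc n) ^ k) sums mzv
    (word [k])"
proof -
  assume k: "k > 1"
  hence "mzv_coeff (word [k]) sums mzv (word [k])"
    by (intro admissible_sums) (simp add: admissible_word_Cons del: word.simps)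
  hence "(\<lambda>n. mzv_coeff (word [k]) (Suc n)) sums (mzv (word [k]) - mzv_coeff (word [k]) 0)"
    by (subst sums_Suc_iff) simp
  thus ?thesis using k mzv_coeff_singleton[of k] by (simp del: word.simps of_nat_Suc)
qed

lemma zeta_of_nat:
  assumes "k > 1"
  shows "zeta (of_nat k) = of_real (mzv (word [k]))"
proof -
  have "(\<lambda>n. complex_of_real (1 / real (Suc n) ^ k)) sums of_real (mzv (word [k]))"
    using mzv_singleton_sums[OF assms] by (subst sums_of_real_iff)
  moreover have "complex_of_real (1 / real (Suc n) ^ k) = of_nat (Suc n) powr (- of_nat k)" for n
  proof -
    have "of_nat (Suc n) powr (of_nat k :: complex) = of_nat (Suc n) ^ k"
      by (intro powr_nat') (simp del: of_nat_Suc)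
    thus ?thesis by (simp add: powr_minus divide_inverse del: of_nat_Suc)
  qed
  ultimately show ?thesis unfolding zeta_def by (simp add: sums_iff)
qed

text \<open>All terms are nonnegative, so the iterated sum, with k2 inside and k1 outside, also
  gives the unordered sum over pairs.\<close>

lemma double_zeta_eq:
  assumes "a > 1" "b > 0"
  shows "double_zeta a b = of_real (mzv (word [a, b]))"
proof -
  let ?f = "\<lambda>(k1, k2). 1 / (real k1 ^ a * real k2 ^ b)"
  let ?S = "SIGMA k1:UNIV. {0<..<k1}"
  have inner: "((\<lambda>k2. ?f (k1, k2)) has_sum mzv_coeff (word [a, b]) k1) {0<..<k1}" for k1
      :: nat
  proof (rule has_sum_finiteI)
    have "(\<Sum>m<k1. mzv_coeff (word [b]) m) = (\<Sum>m\<in>{0<..<k1}. 1 / real m ^ b)"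
      using mzv_coeff_singleton[OF assms(2)] by (intro sum.mono_neutral_cong_right) auto
    thus "mzv_coeff (word [a, b]) k1 = (\<Sum>k2\<in>{0<..<k1}. ?f (k1, k2))"
      using assms(1) by (subst mzv_coeff_word_Cons) (auto simp: sum_divide_distrib mult.commute)
  qed auto
  have outer: "(mzv_coeff (word [a, b]) has_sum mzv (word [a, b])) UNIV"
    using assms by (intro sums_nonneg_imp_has_sum admissible_sums mzv_coeff_nonneg)
      (simp add: admissible_word_Cons del: word.simps)
  have "?f summable_on ?S"
    by (rule summable_on_SigmaI[OF inner has_sum_imp_summable[OF outer]]) auto
  from has_sum_SigmaI[OF inner outer this] have "(?f has_sum mzv (word [a, b])) ?S" .
  hence "((\<lambda>x. complex_of_real (?f x)) has_sum of_real (mzv (word [a, b]))) ?S"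
    by (subst has_sum_of_real_iff)
  also have "(\<lambda>x. complex_of_real (?f x)) = (\<lambda>(k1, k2). 1 / (of_nat k1 ^ a *
      of_nat k2 ^ b))"
    by auto
  also have "?S = {(k1, k2). k1 > k2 \<and> k2 > 0}" by auto
  finally show ?thesis unfolding double_zeta_def by (rule infsumI)
qed

section \<open>Taylor coefficients of the Gamma quotient\<close>

lemma gamma_quot_has_field_derivative:
  assumes "Re z > -1/4"
  shows "(gamma_quot has_field_derivative gamma_quot z * (2 * (Digamma (1 * z + 1) - Digamma (2 *
      z + 1)))) (at z)"
proof -
  have "Re (1 + z) > 0" "Re (1 + 2 * z) > 0" using assms by auto
  hence "1 + z \<notin> \<int>\<^sub>\<le>\<^sub>0" "1 + 2 * z \<notin>
      \<int>\<^sub>\<le>\<^sub>0" by (auto elim!: nonpos_Ints_cases simp del: Re_complex_of_real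
      plus_complex.simps)
  thus ?thesis unfolding gamma_quot_def
    by (auto intro!: derivative_eq_intros simp: Gamma_eq_zero_iff power2_eq_square field_simps)
qed

lemma gamma_quot_holomorphic: "gamma_quot holomorphic_on {z. Re z > -1/4}"
  using gamma_quot_has_field_derivative
  by (subst holomorphic_on_open) (auto simp: open_halfspace_Re_gt)

definition gamma_quot_fps :: "complex fps" where "gamma_quot_fps = fps_expansion gamma_quot 0"

lemma gamma_quot_has_fps_expansion: "gamma_quot has_fps_expansion gamma_quot_fps"
  unfolding gamma_quot_fps_def using gamma_quot_holomorphic
  by (intro has_fps_expansion_fps_expansion[of "{z. Re z > -1/4}"]) (auto simp:
      open_halfspace_Re_gt)

lemma Polygamma_1:
  assumes "j > 0"
  shows "Polygamma j (1 :: complex) = (-1) ^ Suc j * fact j * of_real (mzv (word [Suc j]))"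
proof -
  have "(\<lambda>k. complex_of_real (1 / real (Suc k) ^ Suc j)) sums of_real (mzv (word [Suc j]))"
    using mzv_singleton_sums[of "Suc j"] assms by (subst sums_of_real_iff) simp
  also have "(\<lambda>k. complex_of_real (1 / real (Suc k) ^ Suc j)) = (\<lambda>k. inverse ((1 +
      of_nat k) ^ Suc j))"
    by (simp add: field_simps)
  finally show ?thesis using assms unfolding Polygamma_def by (simp add: sums_iff)
qed

text \<open>Coefficient comparison in g' = g L, where the logarithmic derivative L is a difference
  of Digamma functions. The factor 1 - 2^j vanishes at j = 0, so Euler's constant drops out and only
  zeta values remain.\<close>

lemma gamma_quot_fps_recurrence:
  "of_nat (Suc n) * fps_nth gamma_quot_fps (Suc n) =
     (\<Sum>i=0..n. fps_nth gamma_quot_fps i * (2 * (1 - 2 ^ (n - i)) * (Polygamma (n - i) 1 /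
         fact (n - i))))"
proof -
  let ?A = "{z::complex. Re z > -1/4}" and ?B = "{z::complex. Re z > 0}"
  \<comment> \<open>The factor 1 gives both Digamma terms the form
    \<open>Digamma (c * z + 1)\<close>, so that \<open>m\<close> and \<open>lin\<close> can treat c
    = 1 and c = 2 together.\<close>
  let ?L = "\<lambda>z::complex. 2 * (Digamma (1 * z + 1) - Digamma (2 * z + 1))"
  have A: "open ?A" "0 \<in> ?A" and B: "open ?B" by (auto simp: open_halfspace_Re_gt)
  have Bn: "Digamma holomorphic_on ?B"
    by (intro holomorphic_on_Polygamma) (auto elim!: nonpos_Ints_cases)
  have m: "(\<lambda>z. Digamma (c * z + 1)) holomorphic_on ?A" if "c = 1 \<or> c = 2" for c ::
      complex
  proof (rule holomorphic_on_compose_gen[OF _ Bn, unfolded o_def])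
    show "(\<lambda>z. c * z + 1) ` ?A \<subseteq> ?B" using that by auto
  qed (intro holomorphic_intros)
  have L: "?L holomorphic_on ?A"
    using m[of 1] m[of 2] by (intro holomorphic_intros) auto
  have "deriv gamma_quot has_fps_expansion fps_deriv gamma_quot_fps"
    by (intro has_fps_expansion_deriv gamma_quot_has_fps_expansion)
  moreover have "deriv gamma_quot has_fps_expansion gamma_quot_fps * fps_expansion ?L 0"
  proof -
    have "(\<lambda>z. gamma_quot z * ?L z) has_fps_expansion gamma_quot_fps * fps_expansion ?L 0"
      by (intro has_fps_expansion_mult gamma_quot_has_fps_expansion
          has_fps_expansion_fps_expansion[OF A L])
    moreover have "\<forall>\<^sub>F z in nhds 0. deriv gamma_quot z = gamma_quot z * ?L z"
      using eventually_nhds_in_open[OF A]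
      by eventually_elim (rule DERIV_imp_deriv[OF gamma_quot_has_field_derivative], simp)
    ultimately show ?thesis by (subst has_fps_expansion_cong[OF _ refl])
  qed
  ultimately have "fps_deriv gamma_quot_fps = gamma_quot_fps * fps_expansion ?L 0"
    by (rule fps_expansion_unique_complex)
  hence "fps_nth (fps_deriv gamma_quot_fps) n = fps_nth (gamma_quot_fps * fps_expansion ?L 0) n"
      by simp
  moreover have "fps_nth (fps_expansion ?L 0) j = 2 * (1 - 2 ^ j) * (Polygamma j 1 / fact j)" for j
  proof -
    have lin: "(deriv ^^ j) (\<lambda>z. Digamma (c * z + 1)) 0 = c ^ j * Polygamma j 1" if "c = 1
        \<or> c = 2" for c :: complex
    proof -
      have "(deriv ^^ j) (\<lambda>z. Digamma (c * z + 1)) 0 = c ^ j * (deriv ^^ j) Digamma (c * 0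
          + 1)"
        by (rule higher_deriv_compose_linear'[OF Bn A(1) B A(2)]) (use that in auto)
      thus ?thesis by (simp add: higher_deriv_Polygamma)
    qed
    have hol: "(\<lambda>z. Digamma (1 * z + 1) - Digamma (2 * z + 1)) holomorphic_on ?A"
      by (intro holomorphic_intros m) auto
    have "(deriv ^^ j) ?L 0 = 2 * (deriv ^^ j) (\<lambda>z. Digamma (1 * z + 1) - Digamma (2 * z +
        1)) 0"
      by (rule higher_deriv_cmult[OF hol A(2,1)])
    also have "(deriv ^^ j) (\<lambda>z::complex. Digamma (1 * z + 1) - Digamma (2 * z + 1)) 0 =
        (deriv ^^ j) (\<lambda>z. Digamma (1 * z + 1)) 0 - (deriv ^^ j) (\<lambda>z. Digamma (2 *
            z + 1)) 0"
      by (rule higher_deriv_diff[OF m m A]) auto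
    also have "\<dots> = (1 - 2 ^ j) * Polygamma j 1"
      unfolding lin[OF disjI1[OF refl]] lin[OF disjI2[OF refl]] by (simp add: algebra_simps)
    finally show ?thesis by (simp add: fps_expansion_def)
  qed
  ultimately show ?thesis by (simp add: fps_mult_nth)
qed

lemma gamma_quot_fps_0: "fps_nth gamma_quot_fps 0 = 1"
  by (simp add: gamma_quot_fps_def fps_expansion_def gamma_quot_def)

section \<open>The summand, its derivatives and their sum\<close>

definition f2_complex :: "complex \<Rightarrow> complex" where
  "f2_complex z = exp (of_real pi * \<i> * z) * central_term z"

lemma f2_eq: "x > 0 \<Longrightarrow> f2 x = f2_complex (of_real x)"
  by (simp add: f2_def f2_complex_def central_term_def Gamma_complex_of_real[symmetric])

lemma central_term_holomorphic: "central_term holomorphic_on {z. Re z > 0}"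
proof -
  have "z + 1 \<notin> \<int>\<^sub>\<le>\<^sub>0" "2 * z + 1 \<notin> \<int>\<^sub>\<le>\<^sub>0"
      if "Re z > 0" for z
  proof -
    have "Re (z + 1) > 0" "Re (2 * z + 1) > 0" using that by auto
    thus "z + 1 \<notin> \<int>\<^sub>\<le>\<^sub>0" "2 * z + 1 \<notin>
        \<int>\<^sub>\<le>\<^sub>0" by (auto elim!: nonpos_Ints_cases simp del: plus_complex.simps)
  qed
  thus ?thesis unfolding central_term_def
    by (intro holomorphic_intros) (auto simp: Gamma_eq_zero_iff)
qed

lemma f2_complex_holomorphic: "f2_complex holomorphic_on {z. Re z > 0}"
  unfolding f2_complex_def by (intro holomorphic_intros central_term_holomorphic)

text \<open>The derivative of a holomorphic function restricted to the real line is the restriction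
  of its complex derivative. Openness of \<open>S\<close> lets the induction hypothesis hold in a
  neighbourhood.\<close>

lemma nth_deriv_of_real:
  assumes f: "f holomorphic_on A" "open A" and S: "open S" "\<And>x. x \<in> S \<Longrightarrow>
      of_real x \<in> A"
    and g: "\<And>x. x \<in> S \<Longrightarrow> g x = f (of_real x)" and x: "x \<in> S"
  shows "nth_deriv m g x = (deriv ^^ m) f (of_real x)"
  using x
proof (induction m arbitrary: x)
  case (Suc m)
  have "((deriv ^^ m) f has_field_derivative (deriv ^^ Suc m) f (of_real x)) (at (of_real x))"
    using has_field_derivative_higher_deriv[OF f] S Suc.prems by blast
  hence "((\<lambda>x. (deriv ^^ m) f (of_real x)) has_vector_derivative (deriv ^^ Suc m) f
      (of_real x)) (at x)"
    by (rule has_vector_derivative_real_field)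
  hence "(nth_deriv m g has_vector_derivative (deriv ^^ Suc m) f (of_real x)) (at x)"
    by (rule has_vector_derivative_transform_within_open[OF _ S(1) Suc.prems]) (simp add: Suc.IH)
  thus ?case by (simp add: nth_deriv_def vector_derivative_at)
qed (use g in \<open>simp add: nth_deriv_def\<close>)

definition f2_series :: "complex \<Rightarrow> complex" where
  "f2_series z = -2/5 * (exp (of_real pi * \<i> * z) * (gamma_quot z * dual_series z))"

definition f2_fps :: "complex fps" where
  "f2_fps = fps_const (-2/5) * (fps_exp (of_real pi * \<i>) * (gamma_quot_fps * Abs_fps
      (\<lambda>m. of_real (dual_mzv m))))"

lemma f2_series_fps: "f2_series has_fps_expansion f2_fps"
  unfolding f2_series_def f2_fps_def
  by (intro has_fps_expansion_cmult_left has_fps_expansion_mult has_fps_expansion_exp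
      gamma_quot_has_fps_expansion dual_series_has_fps_expansion)

lemma f2_complex_shift:
  "f2_complex (of_nat (Suc k) + z) = - ((-1) ^ k * (exp (of_real pi * \<i> * z) * central_term (z
      + of_nat k + 1)))"
proof -
  have "exp (of_real pi * \<i> * (of_nat (Suc k) + z)) =
     exp (of_nat (Suc k) * (of_real pi * \<i>)) * exp (of_real pi * \<i> * z)"
    unfolding exp_add[symmetric] by (rule arg_cong[of _ _ exp]) (simp add: algebra_simps)
  also have "exp (of_nat (Suc k) * (of_real pi * \<i>)) = (-1) ^ Suc k"
    unfolding exp_of_nat_mult by simp
  finally show ?thesis by (simp add: f2_complex_def add_ac)
qed

text \<open>The summands are translated to functions of z near 0, where their sum is
  \<open>f2_series\<close>; termwise differentiation at z = 0 gives both convergence and value.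
  Radius 1/4 keeps z inside the half-plane of all previous estimates.\<close>

lemma f2_deriv_sums:
  "(\<lambda>k. nth_deriv m f2 (real (Suc k))) sums (fact m * fps_nth f2_fps m)"
proof -
  let ?A = "ball (0::complex) (1/4)"
  have A: "open ?A" "0 \<in> ?A" by auto
  have ReA: "Re z > -1/4" if "z \<in> ?A" for z
    using that abs_Re_le_cmod[of z] by (simp add: dist_norm)
  have hol: "(\<lambda>z. f2_complex (of_nat (Suc k) + z)) holomorphic_on ?A" for k
  proof (rule holomorphic_on_compose_gen[OF _ f2_complex_holomorphic, unfolded o_def])
    show "(+) (of_nat (Suc k)) ` ?A \<subseteq> {z. 0 < Re z}" using ReA by fastforce
  qed (intro holomorphic_intros)
  \<comment> \<open>The summand with index 1 is bounded on the closed disc, and the later ones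
    shrink by 1/4 at each step. This gives a geometric majorant independent of z.\<close>
  have "compact ((\<lambda>z. exp (of_real pi * \<i> * z) * central_term (z + 1)) ` cball 0 (1/4))"
  proof (intro compact_continuous_image compact_cball continuous_intros)
    have "Re (z + 1) > 0" if "z \<in> cball 0 (1/4)" for z
      using Re_cball_quarter[of z] that by (simp add: dist_norm)
    thus "continuous_on (cball 0 (1/4)) (\<lambda>z. central_term (z + 1))"
      by (intro continuous_on_compose2[OF holomorphic_on_imp_continuous_on[OF
          central_term_holomorphic]] continuous_intros)
         blast
  qed
  hence "bounded ((\<lambda>z. exp (of_real pi * \<i> * z) * central_term (z + 1)) ` cball 0 (1/4))"
    by (rule compact_imp_bounded)
  then obtain B where "\<forall>x \<in> (\<lambda>z. exp (of_real pi * \<i> * z) * central_term (z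
      + 1)) ` cball 0 (1/4). norm x \<le> B"
    unfolding bounded_iff ..
  hence B: "norm (exp (of_real pi * \<i> * z) * central_term (z + 1)) \<le> B" if "z \<in> cball 0
      (1/4)" for z
    using that by (rule bspec[OF _ imageI])
  have u: "norm (central_term (z + of_nat k + 1)) \<le> (1/4) ^ k * norm (central_term (z + 1))"
      if "z \<in> ?A" for z k
  proof (induction k)
    case (Suc k)
    have "norm (central_term ((z + of_nat k + 1) + 1)) \<le> 1/4 * norm (central_term (z + of_nat
        k + 1))"
      using ReA[OF that] by (intro norm_central_term_plus1_le) simp
    thus ?case using Suc by (simp add: add_ac)
  qed auto
  have M: "norm (f2_complex (of_nat (Suc k) + z)) \<le> (1/4) ^ k * B" if "z \<in> ?A" for z k
  proof -
    have "norm (f2_complex (of_nat (Suc k) + z)) = norm (exp (of_real pi * \<i> * z)) * norm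
        (central_term (z + of_nat k + 1))"
      unfolding f2_complex_shift by (simp add: norm_mult norm_power)
    also have "\<dots> \<le> norm (exp (of_real pi * \<i> * z)) * ((1/4) ^ k * norm (central_term
        (z + 1)))"
      by (intro mult_left_mono u that) auto
    also have "\<dots> = (1/4) ^ k * norm (exp (of_real pi * \<i> * z) * central_term (z + 1))"
      by (simp add: norm_mult)
    also have "\<dots> \<le> (1/4) ^ k * B"
      by (intro mult_left_mono B) (use that in auto)
    finally show ?thesis .
  qed
  have sM: "summable (\<lambda>k. (1/4) ^ k * B)"
    by (intro summable_mult2 summable_geometric) auto
  have S: "(\<lambda>k. f2_complex (of_nat (Suc k) + z)) sums f2_series z" if "z \<in> ?A" for z
  proof -
    have "(\<lambda>k. - exp (of_real pi * \<i> * z) * ((-1) ^ k * central_term (z + of_nat k +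
        1))) sums
        (- exp (of_real pi * \<i> * z) * (2 / 5 * gamma_quot z * dual_series z))"
      using ReA[OF that] by (intro sums_mult central_term_alternating_sums) simp
    thus ?thesis unfolding f2_complex_shift f2_series_def by (simp add: mult_ac)
  qed
  have "(\<lambda>k. (deriv ^^ m) (\<lambda>z. f2_complex (of_nat (Suc k) + z)) 0) sums (deriv ^^
      m) f2_series 0"
    by (rule higher_deriv_series_sums(1)[OF A hol M sM S])
  moreover have "(deriv ^^ m) (\<lambda>z. f2_complex (of_nat (Suc k) + z)) 0 = nth_deriv m f2
      (real (Suc k))" for k
  proof -
    have "nth_deriv m f2 (real (Suc k)) = (deriv ^^ m) f2_complex (of_real (real (Suc k)))"
      by (rule nth_deriv_of_real[OF f2_complex_holomorphic, of "{0<..}"])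
         (auto simp: f2_eq open_halfspace_Re_gt)
    also have "\<dots> = (deriv ^^ m) (\<lambda>z. f2_complex (of_nat (Suc k) + z)) 0"
      by (subst higher_deriv_shift_0) (simp add: o_def)
    finally show ?thesis ..
  qed
  moreover have "(deriv ^^ m) f2_series 0 = fact m * fps_nth f2_fps m"
    using fps_nth_fps_expansion[OF f2_series_fps, of m] by simp
  ultimately show ?thesis by simp
qed

section \<open>Certified evaluations\<close>

text \<open>
  \<open>certifies L m ms cs\<close> states that \<open>L\<close> times the \<open>m\<close>-th
  Taylor coefficient of \<open>V\<close> plus the polynomial \<open>ms\<close> in multiple zeta
  values is cancelled by the combination \<open>cs\<close> of double shuffle relations.
\<close>

definition certifies :: "int \<Rightarrow> nat \<Rightarrow> (int \<times> nat list list) list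
    \<Rightarrow> (int \<times> nat list \<times> nat list) list \<Rightarrow> bool" where
  "certifies L m ms cs \<longleftrightarrow> certificate_ok cs \<and> list_all (\<lambda>(c, us).
      list_all index_ok us) ms \<and>
     trie_zero (certificate_trie cs (combination_trie
       (map (\<lambda>(c, ws). (L * c, ws)) (dual_words m) @ map (\<lambda>(c, us). (c, map word
           (stuffle_list us))) ms)))"

lemma certifiesD:
  assumes "certifies L m ms cs"
  shows "of_int L * dual_mzv m + (\<Sum>(c, us)\<leftarrow>ms. of_int c * (\<Prod>u\<leftarrow>us.
      mzv (word u))) = 0"
proof -
  let ?v = "map (\<lambda>(c, ws). (L * c, ws)) (dual_words m)"
  let ?p = "map (\<lambda>(c, us). (c, map word (stuffle_list us))) ms"
  have "trie_eval mzv (combination_trie (?v @ ?p)) = 0"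
    using assms certificate_sound unfolding certifies_def by blast
  moreover have "(\<Sum>(c, ws)\<leftarrow>?v. of_int c * (\<Sum>w\<leftarrow>ws. mzv w)) = of_int
      L * dual_mzv m"
    unfolding dual_mzv_def trie_eval_combination
    by (simp add: comp_def case_prod_unfold sum_list_const_mult[symmetric] mult.assoc)
  moreover have "(\<Sum>(c, ws)\<leftarrow>?p. of_int c * (\<Sum>w\<leftarrow>ws. mzv w)) =
      (\<Sum>(c, us)\<leftarrow>ms. of_int c * (\<Prod>u\<leftarrow>us. mzv (word u)))"
  proof -
    have ok: "list_all index_ok us" if "(c, us) \<in> set ms" for c us
      using assms that by (auto simp: certifies_def list_all_iff)
    show ?thesis unfolding map_map comp_def
      by (intro arg_cong[of _ _ sum_list] map_cong refl) (auto simp: comp_def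
          stuffle_list_mzv(1)[OF ok])
  qed
  ultimately show ?thesis by (simp add: trie_eval_combination)
qed

text \<open>
  The coefficients below were found by lattice reduction of the integer kernel of the matrix of
  all relations of the given weight.
\<close>

lemma zeta_2_2_certificate:
  "certifies 0 0 [(2, [[2], [2]]), (-5, [[4]])] [
    (4,[1],[3]), (-1,[2],[2])]"
  by code_simp

lemma zeta_2_4_certificate:
  "certifies 0 0 [(4, [[2], [4]]), (-7, [[6]])] [
    (4,[1],[5]), (-2,[2],[4]), (1,[3],[3])]"
  by code_simp

lemma zeta_2_6_certificate:
  "certifies 0 0 [(3, [[2], [6]]), (-5, [[8]])] [
    (3,[1],[7]), (-1,[2],[3,3]), (-1,[2],[6]), (2,[2],[5,1]), (-3,[3],[4,1]), (-1,[3],[5]),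
    (2,[3,1],[4]), (1,[4],[4])]"
  by code_simp

text \<open>The combination for m = 0 is the single word of zeta(3), so no relation is
  spent.\<close>

lemma dual_mzv_0_certificate:
  "certifies 1 0 [(-1, [[3]])] []"
  by code_simp

text \<open>The two expansions of zeta(2)^2 differ by zeta(4) - 4 zeta(3,1), which is the whole
  reduction.\<close>

lemma dual_mzv_1_certificate:
  "certifies 2 1 [(9, [[4]])] [
    (-1,[2],[2])]"
  by code_simp

lemma dual_mzv_2_certificate:
  "certifies 5 2 [(-65, [[5]])] [
    (-4,[1],[3,1]), (4,[1],[4]), (4,[2],[2,1]), (6,[2],[3])]"
  by code_simp

lemma dual_mzv_3_certificate:
  "certifies 15 3 [(15, [[3], [3]]), (450, [[6]])] [
    (24,[1],[3,1,1]), (24,[1],[3,2]), (48,[1],[4,1]), (-54,[1],[5]), (-6,[2],[2,2]), (2,[2],[4]),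
    (16,[2],[3,1]), (-48,[2,1],[3]), (-12,[2,1],[2,1]), (-23,[3],[3])]"
  by code_simp

lemma dual_mzv_4_certificate:
  "certifies 1 4 [(-9, [[4], [3]]), (-58, [[7]])] [
    (-2,[1],[2,1,2,1]), (2,[1],[2,1,3]), (-2,[1],[2,2,1,1]), (-19,[1],[2,2,2]), (-5,[1],[2,3,1]),
    (14,[1],[2,4]), (-4,[1],[3,1,1,1]), (6,[1],[3,1,2]), (-1,[1],[3,2,1]), (15,[1],[3,3]),
    (12,[1],[4,1,1]), (-41,[1],[4,2]), (-126,[1],[5,1]), (-11,[1],[6]), (-3,[2],[2,1,2]),
    (-6,[2],[2,2,1]), (24,[2],[2,3]), (24,[2],[3,2]), (-1,[2,1],[2,2]), (5,[3],[2,2]),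
    (2,[2],[2,1,1,1]), (48,[2],[5]), (-21,[2],[3,1,1]), (32,[2],[4,1]), (-54,[2,1],[4]),
    (15,[3],[2,1,1]), (5,[2,1],[3,1]), (25,[3],[3,1]), (-27,[3],[4])]"
  by code_simp

text \<open>In this weight the double value zeta(5,3) is kept as a further generator besides
  products of zeta values.\<close>

lemma dual_mzv_5_certificate:
  "certifies 40 5 [(1040, [[3], [5]]), (4595, [[8]]), (160, [[5,3]])] [
    (-54,[1],[2,1,1,2,1]), (54,[1],[2,1,1,3]), (12,[1],[2,1,2,1,1]), (-40,[1],[2,1,2,2]),
    (-26,[1],[2,1,3,1]), (-70,[1],[2,1,4]), (34,[1],[2,2,1,1,1]), (88,[1],[2,2,1,2]),
    (62,[1],[2,2,2,1]), (59,[1],[2,2,3]), (-54,[1],[2,3,1,1]), (23,[1],[2,3,2]), (79,[1],[2,4,1]),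
    (-22,[1],[2,5]), (252,[1],[3,1,1,1,1]), (48,[1],[3,1,1,2]), (-24,[1],[3,1,2,1]),
    (270,[1],[3,1,3]), (118,[1],[3,2,1,1]), (92,[1],[3,2,2]), (20,[1],[3,3,1]), (191,[1],[3,4]),
    (332,[1],[4,1,1,1]), (335,[1],[4,1,2]), (68,[1],[4,2,1]), (390,[1],[4,3]), (-34,[1],[5,1,1]),
    (591,[1],[5,2]), (644,[1],[6,1]), (-653,[1],[7]), (-26,[2],[2,2,2]), (112,[2],[2,1,2,1]),
    (-10,[2],[2,1,3]), (-34,[2],[3,3]), (10,[2],[2,1,1,2]), (148,[2],[2,2,1,1]), (-140,[2],[2,4]),
    (-87,[2],[4,2]), (95,[2],[2,3,1]), (-29,[2],[3,1,2]), (-62,[2],[3,2,1]), (-236,[2,1],[2,3]),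
    (-9,[3],[2,1,2]), (54,[2],[2,1,1,1,1]), (65,[2],[6]), (-82,[2,1],[2,1,2]),
    (-122,[2,1],[2,2,1]), (-172,[2,1],[3,2]), (1,[3],[2,2,1]), (-152,[3],[3,2]),
    (12,[2,1,1],[2,2]), (78,[2,2],[3,1]), (170,[2,2],[4]), (106,[2],[3,1,1,1]), (186,[2],[5,1]),
    (-661,[2,1],[5]), (-134,[3],[2,1,1,1]), (-324,[2],[4,1,1]), (67,[2,1,1],[4]), (8,[2,2],[2,2]),
    (117,[2,1],[4,1]), (-582,[3],[3,1,1]), (-66,[2,1],[2,1,1,1]), (-174,[2,1],[3,1,1]),
    (344,[3],[4,1]), (-544,[3],[5]), (92,[2,1,1],[3,1]), (-266,[3,1],[4]), (329,[3,1],[3,1]),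
    (-5,[2,1,1],[2,1,1]), (297,[4],[4])]"
  by code_simp

lemma dual_mzv_6_certificate:
  "certifies 3 6 [(-180, [[6], [3]]), (-2, [[3], [3], [3]]), (-81, [[4], [5]]), (-598, [[9]])] [
    (-18,[1],[2,1,1,1,2,1]), (18,[1],[2,1,1,1,3]), (-33,[1],[2,1,1,2,1,1]), (12,[1],[2,1,1,2,2]),
    (42,[1],[2,1,1,3,1]), (-18,[1],[2,1,1,4]), (-57,[1],[2,1,2,1,1,1]), (24,[1],[2,1,2,1,2]),
    (6,[1],[2,1,2,2,1]), (-12,[1],[2,1,2,3]), (21,[1],[2,1,3,1,1]), (18,[1],[2,1,3,2]),
    (3,[1],[2,1,4,1]), (15,[1],[2,1,5]), (-60,[1],[2,2,1,1,1,1]), (-27,[1],[2,2,1,1,2]),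
    (-18,[1],[2,2,1,2,1]), (-45,[1],[2,2,1,3]), (-9,[1],[2,2,2,1,1]), (84,[1],[2,2,2,2]),
    (-48,[1],[2,2,3,1]), (12,[1],[2,2,4]), (-3,[1],[2,3,1,1,1]), (-18,[1],[2,3,1,2]),
    (-24,[1],[2,3,2,1]), (-24,[1],[2,3,3]), (39,[1],[2,4,1,1]), (15,[1],[2,4,2]),
    (-57,[1],[2,5,1]), (15,[1],[2,6]), (-60,[1],[3,1,1,1,1,1]), (-42,[1],[3,1,1,1,2]),
    (-21,[1],[3,1,1,2,1]), (-69,[1],[3,1,1,3]), (-3,[1],[3,1,2,1,1]), (-24,[1],[3,1,2,2]),
    (9,[1],[3,1,3,1]), (-54,[1],[3,1,4]), (-33,[1],[3,2,1,2]), (-18,[1],[3,2,2,1]),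
    (-30,[1],[3,2,3]), (18,[1],[3,3,1,1]), (-21,[1],[3,3,2]), (-84,[1],[3,4,1]), (-9,[1],[3,5]),
    (-51,[1],[4,1,1,1,1]), (-57,[1],[4,1,1,2]), (9,[1],[4,1,2,1]), (-45,[1],[4,1,3]),
    (-3,[1],[4,2,1,1]), (-18,[1],[4,2,2]), (-54,[1],[4,3,1]), (-15,[1],[4,4]), (9,[1],[5,1,1,1]),
    (-33,[1],[5,1,2]), (21,[1],[5,2,1]), (-30,[1],[5,3]), (-21,[1],[6,1,1]), (-108,[1],[6,2]),
    (-93,[1],[7,1]), (69,[1],[8]), (18,[2],[2,1,2,2]), (3,[2],[2,2,1,2]), (-9,[2],[2,2,2,1]),
    (-12,[2],[2,2,3]), (-9,[2],[2,3,2]), (36,[2],[3,2,2]), (-6,[2],[2,1,1,2,1]),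
    (33,[2],[2,1,1,3]), (-15,[2],[2,1,2,1,1]), (45,[2],[2,1,4]), (21,[2],[3,4]), (-15,[2],[4,3]),
    (3,[3],[2,2,2]), (3,[2],[2,1,3,1]), (33,[2],[3,1,2,1]), (-6,[2],[3,1,3]), (33,[2],[3,3,1]),
    (-3,[2],[2,1,1,1,2]), (-27,[2],[2,2,1,1,1]), (36,[2],[2,5]), (36,[2],[5,2]),
    (6,[2],[2,3,1,1]), (3,[2],[2,4,1]), (60,[2],[3,1,1,2]), (27,[2],[3,2,1,1]), (18,[2],[4,1,2]),
    (24,[2],[4,2,1]), (-27,[2,1],[2,1,3]), (-9,[2,1],[2,4]), (48,[2,1],[3,3]),
    (-36,[3],[2,1,1,2]), (-3,[3],[2,1,2,1]), (-27,[3],[2,1,3]), (33,[2,1,1],[2,3]),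
    (6,[4],[2,1,2]), (18,[2],[2,1,1,1,1,1]), (18,[2],[7]), (33,[2,1],[4,2]), (-6,[3],[2,2,1,1]),
    (39,[2],[3,1,1,1,1]), (45,[2],[6,1]), (3,[2,1],[2,1,2,1]), (-39,[2,1],[2,3,1]),
    (3,[2,1],[3,1,2]), (-18,[2,1],[3,2,1]), (51,[2,1],[6]), (-33,[3],[2,1,1,1,1]),
    (33,[3],[2,3,1]), (15,[3],[3,1,2]), (30,[3],[3,2,1]), (27,[3],[3,3]), (-3,[2,1,1],[3,2]),
    (-27,[2,2],[2,1,1,1]), (-12,[2,2],[3,1,1]), (-27,[2,2],[4,1]), (-15,[2,2],[5]),
    (15,[3,1],[2,1,2]), (3,[3,1],[2,3]), (3,[4],[2,2,1]), (-18,[2],[4,1,1,1]), (69,[2],[5,1,1]),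
    (9,[2,1],[2,1,1,2]), (12,[2,1],[2,2,1,1]), (12,[3],[4,2]), (-24,[2,1,1],[5]),
    (36,[4],[2,1,1,1]), (18,[2,1,1],[2,1,2]), (21,[2,1,1],[2,2,1]), (12,[2,2],[2,1,2]),
    (-3,[2,2],[2,2,1]), (27,[2,2],[2,3]), (-24,[2,2],[3,2]), (18,[3,1],[2,2,1]),
    (-36,[3,1],[3,2]), (-18,[4],[2,3]), (-6,[4],[3,2]), (-102,[2,1],[5,1]), (-51,[3],[3,1,1,1]),
    (24,[2,1],[4,1,1]), (60,[3],[4,1,1]), (-9,[2,1,1],[4,1]), (75,[4],[3,1,1]),
    (15,[2,1],[2,1,1,1,1]), (69,[3],[6]), (-9,[2,1],[3,1,1,1]), (-75,[3],[5,1]),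
    (-9,[3,1],[2,1,1,1]), (51,[3,1],[5]), (18,[2,1,1],[3,1,1]), (18,[3,1],[3,1,1]),
    (-42,[3,1],[4,1]), (-9,[2,1,1],[2,1,1,1]), (-36,[4],[5])]"
  by code_simp

section \<open>Explicit Taylor coefficients\<close>

abbreviation zv :: "nat \<Rightarrow> real" where
  "zv k \<equiv> mzv (word [k])"

lemma zv_2: "zv 2 = pi ^ 2 / 6"
  using mzv_singleton_sums[of 2] inverse_squares_sums by (auto simp: sums_iff add_ac)

text \<open>Certificates with L = 0 do not involve V: they express zeta(2)^2, zeta(2) zeta(4) and
  zeta(2) zeta(6) by zeta(4), zeta(6) and zeta(8). The Basel sum therefore determines all
  three.\<close>

lemma zv_even: "zv 4 = pi ^ 4 / 90" "zv 6 = pi ^ 6 / 945" "zv 8 = pi ^ 8 / 9450"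
proof -
  show 4: "zv 4 = pi ^ 4 / 90"
    using certifiesD[OF zeta_2_2_certificate] by (simp add: zv_2 field_simps del: word.simps)
  show 6: "zv 6 = pi ^ 6 / 945"
    using certifiesD[OF zeta_2_4_certificate] by (simp add: zv_2 4 field_simps del: word.simps)
  show 8: "zv 8 = pi ^ 8 / 9450"
    using certifiesD[OF zeta_2_6_certificate] by (simp add: zv_2 6 field_simps del: word.simps)
qed

text \<open>Even zeta values are replaced by powers of pi, so that the final comparison takes place
  between polynomials in pi, the odd zeta values and zeta(5,3).\<close>

lemma dual_mzv_values:
  "dual_mzv 0 = zv 3"
  "dual_mzv (Suc 0) = - (pi ^ 4) / 20"
  "dual_mzv 2 = 13 * zv 5"
  "dual_mzv 3 = - (zv 3 ^ 2) - 2 * pi ^ 6 / 63"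
  "dual_mzv 4 = pi ^ 4 / 10 * zv 3 + 58 * zv 7"
  "dual_mzv 5 = - 26 * zv 3 * zv 5 - 919 * pi ^ 8 / 75600 - 4 * mzv (word [5, 3])"
  "dual_mzv 6 = 4 * pi ^ 6 / 63 * zv 3 + 2 / 3 * zv 3 ^ 3 + 3 * pi ^ 4 / 10 * zv 5 + 598 / 3 * zv 9"
  using certifiesD[OF dual_mzv_0_certificate] certifiesD[OF dual_mzv_1_certificate]
    certifiesD[OF dual_mzv_2_certificate] certifiesD[OF dual_mzv_3_certificate]
    certifiesD[OF dual_mzv_4_certificate] certifiesD[OF dual_mzv_5_certificate]
    certifiesD[OF dual_mzv_6_certificate]
  by (simp_all add: zv_even field_simps power2_eq_square power3_eq_cube del: word.simps)

lemma gamma_quot_fps_values: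
  "fps_nth gamma_quot_fps (Suc 0) = 0"
  "fps_nth gamma_quot_fps 2 = of_real (- (pi ^ 2) / 6)"
  "fps_nth gamma_quot_fps 3 = of_real (2 * zv 3)"
  "fps_nth gamma_quot_fps 4 = of_real (- (pi ^ 4) / 40)"
  "fps_nth gamma_quot_fps 5 = of_real (6 * zv 5 - pi ^ 2 / 3 * zv 3)"
  "fps_nth gamma_quot_fps 6 = of_real (2 * zv 3 ^ 2 - 79 * pi ^ 6 / 15120)"
proof -
  define L :: "nat \<Rightarrow> complex" where "L j = 2 * (1 - 2 ^ j) * (Polygamma j 1 / fact j)"
      for j
  have L: "L j = of_real (2 * (1 - 2 ^ j) * (-1) ^ Suc j * zv (Suc j))" if "j > 0" for j
    using that by (simp add: L_def Polygamma_1 del: word.simps)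
  have L0: "L 0 = 0" by (simp add: L_def)
  have L': "L (Suc 0) = of_real (- (pi ^ 2) / 3)" "L 2 = of_real (6 * zv 3)" "L 3 = of_real (- 14
      * pi ^ 4 / 90)"
    "L 4 = of_real (30 * zv 5)" "L 5 = of_real (- 62 * pi ^ 6 / 945)"
    by (simp_all add: L zv_2 zv_even numeral_2_eq_2[symmetric] del: word.simps)
  have rec: "of_nat (Suc n) * fps_nth gamma_quot_fps (Suc n) = (\<Sum>i=0..n. fps_nth
      gamma_quot_fps i * L (n - i))" for n
    unfolding L_def by (rule gamma_quot_fps_recurrence)
  have sets: "{0..1::nat} = {0, 1}" "{0..2::nat} = {0, 1, 2}" "{0..3::nat} = {0, 1, 2, 3}"
    "{0..4::nat} = {0, 1, 2, 3, 4}" "{0..5::nat} = {0, 1, 2, 3, 4, 5}" by auto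
  note simps = sets L0 L' gamma_quot_fps_0
  show 1: "fps_nth gamma_quot_fps (Suc 0) = 0"
    using rec[of 0] by (simp add: L0)
  show 2: "fps_nth gamma_quot_fps 2 = of_real (- (pi ^ 2) / 6)"
    using rec[of 1, unfolded simps] by (simp add: L0 L' gamma_quot_fps_0 1 field_simps flip:
        numeral_2_eq_2 del: word.simps)
  show 3: "fps_nth gamma_quot_fps 3 = of_real (2 * zv 3)"
    using rec[of 2, unfolded simps] by (simp add: L0 L' gamma_quot_fps_0 1 2 field_simps del:
        word.simps)
  show 4: "fps_nth gamma_quot_fps 4 = of_real (- (pi ^ 4) / 40)"
    using rec[of 3, unfolded simps] by (simp add: L0 L' gamma_quot_fps_0 1 2 3 field_simps del:
        word.simps)
  have rec': "fps_nth gamma_quot_fps (Suc n) =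
      (\<Sum>i=0..n. fps_nth gamma_quot_fps i * L (n - i)) / of_nat (Suc n)" for n
    using rec[of n] by (simp add: field_simps del: of_nat_Suc)
  have "fps_nth gamma_quot_fps (Suc 4) = of_real (6 * zv 5 - pi ^ 2 / 3 * zv 3)"
    unfolding rec'[of 4] by (simp add: simps 1 2 3 4 field_simps del: word.simps)
  thus 5: "fps_nth gamma_quot_fps 5 = of_real (6 * zv 5 - pi ^ 2 / 3 * zv 3)" by (simp del:
      word.simps)
  have "fps_nth gamma_quot_fps (Suc 5) = of_real (2 * zv 3 ^ 2 - 79 * pi ^ 6 / 15120)"
    unfolding rec'[of 5] by (simp add: simps 1 2 3 4 5 field_simps power_numeral_reduce del:
        word.simps)
  thus "fps_nth gamma_quot_fps 6 = of_real (2 * zv 3 ^ 2 - 79 * pi ^ 6 / 15120)" by (simp del: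
      word.simps)
qed

lemma zeta_eqs:
  "zeta 2 = of_real (pi ^ 2 / 6)" "zeta 3 = of_real (zv 3)" "zeta 4 = of_real (pi ^ 4 / 90)"
  "zeta 5 = of_real (zv 5)" "zeta 6 = of_real (pi ^ 6 / 945)" "zeta 7 = of_real (zv 7)"
  "zeta 8 = of_real (pi ^ 8 / 9450)" "zeta 9 = of_real (zv 9)"
  using zeta_of_nat[of 2] zeta_of_nat[of 3] zeta_of_nat[of 4] zeta_of_nat[of 5] zeta_of_nat[of 6]
    zeta_of_nat[of 7] zeta_of_nat[of 8] zeta_of_nat[of 9]
  by (simp_all add: zv_2 zv_even del: word.simps)

lemma f2_fps_nth:
  "fps_nth f2_fps m = -2/5 * (\<Sum>i=0..m. (of_real pi * \<i>) ^ i / fact i *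
      (\<Sum>j=0..m - i. fps_nth gamma_quot_fps j * of_real (dual_mzv (m - i - j))))"
  unfolding f2_fps_def fps_mult_left_const_nth by (simp add: fps_mult_nth)

lemma pi_i_powers:
  "(of_real pi * \<i>) ^ 2 = - (of_real pi ^ 2)" "(of_real pi * \<i>) ^ 3 = - (of_real pi ^ 3) *
      \<i>"
  "(of_real pi * \<i>) ^ 4 = of_real pi ^ 4" "(of_real pi * \<i>) ^ 5 = of_real pi ^ 5 * \<i>"
  "(of_real pi * \<i>) ^ 6 = - (of_real pi ^ 6)"
  by (simp_all add: eval_nat_numeral mult_ac)

theorem theorem1p4:
  shows "(\<forall>m \<in> {2..6}. summable (\<lambda>k. nth_deriv m f2 (real (Suc k)))) \<and>
    (\<Sum>k. nth_deriv 2 f2 (real (Suc k))) =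
      of_real pi ^ 5 / 25 * \<i> + 8 / 15 * of_real pi ^ 2 * zeta 3 - 52 / 5 * zeta 5 \<and>
    5 * (\<Sum>k. nth_deriv 3 f2 (real (Suc k))) =
      4 * of_real pi * \<i> * (of_real pi ^ 2 * zeta 3 - 39 * zeta 5)
      - 6 * (2 * zeta 3 ^ 2 + 3 * zeta 6) \<and>
    5 / 12 * (\<Sum>k. nth_deriv 4 f2 (real (Suc k))) =
      4 * (52 * zeta 2 * zeta 5 - 9 * zeta 3 * zeta 4 - 58 * zeta 7)
      + of_real pi * \<i> * (57 * zeta 6 - 4 * zeta 3 ^ 2) \<and>
    1 / 6 * (\<Sum>k. nth_deriv 5 f2 (real (Suc k))) =
      32 * double_zeta 5 3 - 48 * zeta 3 * zeta 5 + 32 * zeta 2 * zeta 3 ^ 2 - 303 * zeta 8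
      + 8 * of_real pi * \<i> * (26 * zeta 2 * zeta 5 - zeta 3 * zeta 4 - 58 * zeta 7) \<and>
    (\<Sum>k. nth_deriv 6 f2 (real (Suc k))) =
      96 * (696 * zeta 2 * zeta 7 + 3 * zeta 3 * zeta 6 - 2 * zeta 3 ^ 3
            - 351 * zeta 4 * zeta 5 - 598 * zeta 9)
      + 36 * of_real pi * \<i> * (161 * zeta 8 + 16 * zeta 2 * zeta 3 ^ 2
            - 48 * zeta 3 * zeta 5 + 32 * double_zeta 5 3)"
proof -
  \<comment> \<open>Naming the constants turns each of the five evaluations into a polynomial
    identity in these symbols and the imaginary unit.\<close>
  define p z3 z5 z7 z9 d :: complex where "p = of_real pi" and "z3 = of_real (zv 3)"
    and "z5 = of_real (zv 5)" and "z7 = of_real (zv 7)" and "z9 = of_real (zv 9)"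
    and "d = of_real (mzv (word [5, 3]))"
  have sm: "summable (\<lambda>k. nth_deriv m f2 (real (Suc k)))"
    and sum: "(\<Sum>k. nth_deriv m f2 (real (Suc k))) = fact m * fps_nth f2_fps m" for m
    using f2_deriv_sums[of m] by (simp_all only: sums_iff)
  have V: "of_real (dual_mzv 0) = z3" "of_real (dual_mzv (Suc 0)) = - (p ^ 4) / 20"
    "of_real (dual_mzv 2) = 13 * z5" "of_real (dual_mzv 3) = - (z3 ^ 2) - 2 * p ^ 6 / 63"
    "of_real (dual_mzv 4) = p ^ 4 / 10 * z3 + 58 * z7"
    "of_real (dual_mzv 5) = - 26 * z3 * z5 - 919 * p ^ 8 / 75600 - 4 * d"
    "of_real (dual_mzv 6) = 4 * p ^ 6 / 63 * z3 + 2 / 3 * z3 ^ 3 + 3 * p ^ 4 / 10 * z5 + 598 / 3 *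
        z9"
    unfolding dual_mzv_values
    by (simp_all add: p_def z3_def z5_def z7_def z9_def d_def del: word.simps)
  have K: "fps_nth gamma_quot_fps 0 = 1" "fps_nth gamma_quot_fps (Suc 0) = 0" "fps_nth
      gamma_quot_fps 2 = - (p ^ 2) / 6"
    "fps_nth gamma_quot_fps 3 = 2 * z3" "fps_nth gamma_quot_fps 4 = - (p ^ 4) / 40"
    "fps_nth gamma_quot_fps 5 = 6 * z5 - p ^ 2 / 3 * z3" "fps_nth gamma_quot_fps 6 = 2 * z3 ^ 2 -
        79 * p ^ 6 / 15120"
    unfolding gamma_quot_fps_values gamma_quot_fps_0
    by (simp_all add: p_def z3_def z5_def z7_def z9_def d_def del: word.simps)
  have Z: "zeta 2 = p ^ 2 / 6" "zeta 3 = z3" "zeta 4 = p ^ 4 / 90" "zeta 5 = z5" "zeta 6 = p ^ 6 /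
      945"
    "zeta 7 = z7" "zeta 8 = p ^ 8 / 9450" "zeta 9 = z9" "double_zeta 5 3 = d"
    unfolding zeta_eqs
    by (simp_all add: p_def z3_def z5_def z7_def z9_def d_def double_zeta_eq del: word.simps)
  have sets: "{0..1::nat} = {0, 1}" "{0..2::nat} = {0, 1, 2}" "{0..3::nat} = {0, 1, 2, 3}"
    "{0..4::nat} = {0, 1, 2, 3, 4}" "{0..5::nat} = {0, 1, 2, 3, 4, 5}" "{0..6::nat} = {0, 1, 2, 3,
        4, 5, 6}"
    "{0..Suc 0} = {0, 1}" by auto
  note coeff = sum f2_fps_nth sets pi_i_powers[folded p_def] V K Z fact_numeral p_def[symmetric]
  show ?thesis
  proof (intro conjI ballI sm)
    show "(\<Sum>k. nth_deriv 2 f2 (real (Suc k))) =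
      of_real pi ^ 5 / 25 * \<i> + 8 / 15 * of_real pi ^ 2 * zeta 3 - 52 / 5 * zeta 5"
      unfolding sum by (simp add: coeff) (simp add: field_simps eval_nat_numeral)
    show "5 * (\<Sum>k. nth_deriv 3 f2 (real (Suc k))) =
      4 * of_real pi * \<i> * (of_real pi ^ 2 * zeta 3 - 39 * zeta 5)
      - 6 * (2 * zeta 3 ^ 2 + 3 * zeta 6)"
      unfolding sum by (simp add: coeff) (simp add: field_simps eval_nat_numeral)
    show "5 / 12 * (\<Sum>k. nth_deriv 4 f2 (real (Suc k))) =
      4 * (52 * zeta 2 * zeta 5 - 9 * zeta 3 * zeta 4 - 58 * zeta 7)
      + of_real pi * \<i> * (57 * zeta 6 - 4 * zeta 3 ^ 2)"
      unfolding sum by (simp add: coeff) (simp add: field_simps eval_nat_numeral)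
    show "1 / 6 * (\<Sum>k. nth_deriv 5 f2 (real (Suc k))) =
      32 * double_zeta 5 3 - 48 * zeta 3 * zeta 5 + 32 * zeta 2 * zeta 3 ^ 2 - 303 * zeta 8
      + 8 * of_real pi * \<i> * (26 * zeta 2 * zeta 5 - zeta 3 * zeta 4 - 58 * zeta 7)"
      unfolding sum by (simp add: coeff) (simp add: field_simps eval_nat_numeral)
    show "(\<Sum>k. nth_deriv 6 f2 (real (Suc k))) =
      96 * (696 * zeta 2 * zeta 7 + 3 * zeta 3 * zeta 6 - 2 * zeta 3 ^ 3
            - 351 * zeta 4 * zeta 5 - 598 * zeta 9)
      + 36 * of_real pi * \<i> * (161 * zeta 8 + 16 * zeta 2 * zeta 3 ^ 2
            - 48 * zeta 3 * zeta 5 + 32 * double_zeta 5 3)"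
      unfolding sum by (simp add: coeff) (simp add: field_simps eval_nat_numeral)
  qed
qed

end
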